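(* Let $\Omega\subseteq\mathbb{R}^2$ be an open domain and let $u:\Omega\to\mathbb{R}$ be any bounded solution of the translating soliton equation $$\operatorname{div}\left(\frac{\nabla u}{\sqrt{1+|\nabla u|^2}}\right)=-\frac{\partial_3u}{\sqrt{1+|\nabla u|^2}} .$$ Then $$|\nabla u|(p)\le\frac{K}{\operatorname{dist}(p,\partial\Omega)^{1/2}},\qquad p\in\Omega',$$ for any $\Omega'\subsetneq\Omega$ with $\operatorname{dist}(\partial\Omega',\partial\Omega)\ge1$, where $K=K(\|u\|_\infty)>0$ is a universal constant depending only on the supremum norm of $u$. If $\Omega$ satisfies the upward sausages property, this can be strengthened to $$|\nabla u|(p)\le\frac{K}{\operatorname{dist}(p,\partial\Omega)},\qquad p\in\Omega' ,$$ with $K=K(\|u\|_\infty)$.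
   Context: Coordinates on $\mathbb{R}^2$ are $(x_2,x_3)$, $\nabla u=(\partial_2u,\partial_3u)$, $\mathbf{e}_3=(0,1)$. The equation says that $\{(u(x_2,x_3),x_2,x_3)\}\subset\mathbb{R}^3$ is a translating soliton of mean curvature flow with velocity in the $x_3$-direction. Solutions are classical (smooth). The upward sausage of width $\rho>0$ at $p$ is $S^+_\rho(p)=\bigcup_{t\in[0,\rho^2)}(B_\rho(p)+t\,\mathbf{e}_3)$. $\Omega$ has the upward sausages property if $\partial\Omega=\emptyset$ or, when $\partial\Omega\ne\emptyset$, $S^+_\rho(p)\subseteq\Omega$ with $\rho=\operatorname{dist}(p,\partial\Omega)$ for every $p\in\Omega$. If $\partial\Omega=\emptyset$, the distance is $+\infty$ and the right-hand sides are read as $0$. *)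

theory Defs
  imports "HOL-Analysis.Analysis"
begin

text \<open>The plane is \<^typ>\<open>real \<times> real\<close> with its Euclidean norm; a point is the pair
  \<open>(x\<^sub>2, x\<^sub>3)\<close>. Functions are total; only their values on the open domain \<open>\<Omega>\<close> matter.\<close>

type_synonym plane = "real \<times> real"

definition e2 :: plane where "e2 = (1, 0)"

definition e3 :: plane where "e3 = (0, 1)"

definition partial :: "plane \<Rightarrow> (plane \<Rightarrow> real) \<Rightarrow> plane \<Rightarrow> real" where
  "partial e f p = frechet_derivative f (at p) e"

definition grad :: "(plane \<Rightarrow> real) \<Rightarrow> plane \<Rightarrow> plane" where
  "grad f p = (partial e2 f p, partial e3 f p)"

definition divergence :: "(plane \<Rightarrow> plane) \<Rightarrow> plane \<Rightarrow> real" where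
  "divergence F p = partial e2 (\<lambda>q. fst (F q)) p + partial e3 (\<lambda>q. snd (F q)) p"

text \<open>\<open>C\<^sup>k\<close> regularity, intended for open \<open>S\<close>.\<close>

primrec Ck_on :: "nat \<Rightarrow> plane set \<Rightarrow> (plane \<Rightarrow> real) \<Rightarrow> bool" where
  "Ck_on 0 S f \<longleftrightarrow> continuous_on S f"
| "Ck_on (Suc k) S f \<longleftrightarrow>
     (\<forall>p\<in>S. f differentiable (at p)) \<and> Ck_on k S (partial e2 f) \<and> Ck_on k S (partial e3 f)"

definition smooth_on :: "plane set \<Rightarrow> (plane \<Rightarrow> real) \<Rightarrow> bool" where
  "smooth_on S f \<longleftrightarrow> (\<forall>k. Ck_on k S f)"

definition translating_soliton_on :: "plane set \<Rightarrow> (plane \<Rightarrow> real) \<Rightarrow> bool" where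
  "translating_soliton_on \<Omega> u \<longleftrightarrow> smooth_on \<Omega> u \<and>
     (\<forall>p\<in>\<Omega>. divergence (\<lambda>q. grad u q /\<^sub>R sqrt (1 + (norm (grad u q))\<^sup>2)) p
             = - (partial e3 u p / sqrt (1 + (norm (grad u p))\<^sup>2)))"

definition sup_norm_on :: "plane set \<Rightarrow> (plane \<Rightarrow> real) \<Rightarrow> real" where
  "sup_norm_on \<Omega> u = (SUP p\<in>\<Omega>. \<bar>u p\<bar>)"

text \<open>Extended-real-valued because the distance to the empty set is \<open>\<infinity>\<close>, whereas the library
  functions \<^const>\<open>setdist\<close> and \<^const>\<open>infdist\<close> return \<open>0\<close> there.\<close>

definition ext_setdist :: "plane set \<Rightarrow> plane set \<Rightarrow> ereal" where
  "ext_setdist A B = (INF x\<in>A. INF y\<in>B. ereal (dist x y))"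

definition upward_sausage :: "real \<Rightarrow> plane \<Rightarrow> plane set" where
  "upward_sausage \<rho> p = (\<Union>t\<in>{0..<\<rho>\<^sup>2}. (\<lambda>q. q + t *\<^sub>R e3) ` ball p \<rho>)"

definition upward_sausages_property :: "plane set \<Rightarrow> bool" where
  "upward_sausages_property \<Omega> \<longleftrightarrow>
     frontier \<Omega> = {} \<or> (\<forall>p\<in>\<Omega>. upward_sausage (infdist p (frontier \<Omega>)) p \<subseteq> \<Omega>)"

end

theory Submission
  imports Defs
begin

text \<open>Write \<open>w = 1 + |\<nabla>u|\<^sup>2\<close> and let \<open>L\<close> be the drift Laplacian of the graph, so that the equation reads
  \<open>L u = 0\<close>. The soliton is a stationary view of mean curvature flow, whose parabolic cylinders are the
  upward sausages. On a sausage of width \<open>\<rho> \<ge> 1/2\<close> around \<open>p\<close>, the maximum principle is applied twice. First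
  Korevaar's method bounds \<open>w\<close> by a constant depending only on \<open>sup |u|\<close>. Then Bernstein's method, using
  \<open>L |\<nabla>u|\<^sup>2 \<ge> |\<nabla>|\<nabla>u|\<^sup>2|\<^sup>2 / (2 |\<nabla>u|\<^sup>2)\<close> and \<open>L (u\<^sup>2) = 2 |\<nabla>u|\<^sup>2 / w\<close>, improves this to
  \<open>|\<nabla>u|(p) \<le> C / \<rho>\<close>. Every ball of radius \<open>d \<ge> 1\<close> contains the sausage of width \<open>\<surd>d / 2\<close>, which gives the
  rate \<open>d\<close> to the power \<open>-1/2\<close> in general; if there is no boundary, \<open>\<rho>\<close> tends to infinity.\<close>

section \<open>Second derivatives along lines\<close>

lemma partial_decomp:
  assumes "f differentiable (at x)"
  shows "partial d f x = fst d * partial e2 f x + snd d * partial e3 f x"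
proof -
  have lin: "linear (frechet_derivative f (at x))"
    using assms linear_frechet_derivative by blast
  have "d = fst d *\<^sub>R e2 + snd d *\<^sub>R e3"
    by (simp add: e2_def e3_def prod_eq_iff)
  then have "frechet_derivative f (at x) d
      = frechet_derivative f (at x) (fst d *\<^sub>R e2 + snd d *\<^sub>R e3)" by (rule arg_cong)
  then show ?thesis
    by (simp add: partial_def linear_add[OF lin] linear_scale[OF lin])
qed

lemma has_real_derivative_along_line:
  fixes f :: "plane \<Rightarrow> real"
  assumes "f differentiable (at (x + t *\<^sub>R d))"
  shows "((\<lambda>t. f (x + t *\<^sub>R d)) has_real_derivative partial d f (x + t *\<^sub>R d)) (at t)"
proof -
  let ?D = "frechet_derivative f (at (x + t *\<^sub>R d))"
  have D: "(f has_derivative ?D) (at (x + t *\<^sub>R d))"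
    using assms frechet_derivative_works by blast
  have L: "((\<lambda>t. x + t *\<^sub>R d) has_derivative (\<lambda>h. h *\<^sub>R d)) (at t)"
    by (auto intro!: derivative_eq_intros)
  have "((\<lambda>t. f (x + t *\<^sub>R d)) has_derivative (\<lambda>h. ?D (h *\<^sub>R d))) (at t)"
    using diff_chain_at[OF L D] by (simp add: o_def)
  moreover have "(\<lambda>h. ?D (h *\<^sub>R d)) = (*) (partial d f (x + t *\<^sub>R d))"
    using linear_scale[OF linear_frechet_derivative[OF assms]]
    by (auto simp: partial_def)
  ultimately show ?thesis by (simp add: has_field_derivative_def)
qed

lemma partialI:
  assumes "(f has_derivative D) (at x)"
  shows "partial d f x = D d"
  unfolding partial_def using frechet_derivative_at[OF assms] by simp

text \<open>The mean value theorem is applied first in direction \<open>d\<close> to the difference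
  of \<open>f\<close> across \<open>h *\<^sub>R e\<close>, then in direction \<open>e\<close> to
  \<open>partial d f\<close>. The left-hand side is symmetric in \<open>d\<close> and
  \<open>e\<close>.\<close>

lemma double_difference_mvt:
  fixes f :: "plane \<Rightarrow> real"
  assumes h: "0 < h"
    and f: "\<And>s t. 0 \<le> s \<Longrightarrow> s \<le> h \<Longrightarrow> 0 \<le> t \<Longrightarrow> t \<le> h \<Longrightarrow> f differentiable (at (z + s *\<^sub>R d + t *\<^sub>R e))"
    and g: "\<And>s t. 0 \<le> s \<Longrightarrow> s \<le> h \<Longrightarrow> 0 \<le> t \<Longrightarrow> t \<le> h \<Longrightarrow>
              partial d f differentiable (at (z + s *\<^sub>R d + t *\<^sub>R e))"
  obtains s t where "0 \<le> s" "s \<le> h" "0 \<le> t" "t \<le> h"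
    "f (z + h *\<^sub>R d + h *\<^sub>R e) - f (z + h *\<^sub>R d) - f (z + h *\<^sub>R e) + f z
      = h\<^sup>2 * partial e (partial d f) (z + s *\<^sub>R d + t *\<^sub>R e)"
proof -
  define k where "k s = f (z + h *\<^sub>R e + s *\<^sub>R d) - f (z + s *\<^sub>R d)" for s
  have k: "(k has_real_derivative
      (partial d f (z + h *\<^sub>R e + s *\<^sub>R d) - partial d f (z + s *\<^sub>R d))) (at s)"
    if "0 \<le> s" "s \<le> h" for s
    unfolding k_def
    by (intro DERIV_diff has_real_derivative_along_line)
       (use f[of s h] f[of s 0] that h in \<open>auto simp: add_ac\<close>)
  obtain s where s: "0 < s" "s < h"
    "k h - k 0 = (h - 0) * (partial d f (z + h *\<^sub>R e + s *\<^sub>R d) - partial d f (z + s *\<^sub>R d))"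
    using MVT2[OF h k] by blast
  have m: "((\<lambda>t. partial d f (z + s *\<^sub>R d + t *\<^sub>R e)) has_real_derivative
      partial e (partial d f) (z + s *\<^sub>R d + t *\<^sub>R e)) (at t)" if "0 \<le> t" "t \<le> h" for t
    by (intro has_real_derivative_along_line g) (use that s in auto)
  obtain t where t: "0 < t" "t < h"
    "partial d f (z + s *\<^sub>R d + h *\<^sub>R e) - partial d f (z + s *\<^sub>R d + 0 *\<^sub>R e) =
      (h - 0) * partial e (partial d f) (z + s *\<^sub>R d + t *\<^sub>R e)"
    using MVT2[OF h m] by blast
  show thesis
  proof (rule that[of s t])
    show "f (z + h *\<^sub>R d + h *\<^sub>R e) - f (z + h *\<^sub>R d) - f (z + h *\<^sub>R e) + f z
      = h\<^sup>2 * partial e (partial d f) (z + s *\<^sub>R d + t *\<^sub>R e)"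
      using s(3) t(3) by (simp add: k_def add_ac power2_eq_square)
  qed (use s t in auto)
qed

text \<open>Schwarz's theorem. The same double difference quotient equals each mixed derivative at
  some point near \<open>x\<close>, so by continuity the two cannot differ at
  \<open>x\<close>.\<close>

lemma partial_commute:
  assumes S: "open S" "x \<in> S" and f: "Ck_on 2 S f"
  shows "partial e2 (partial e3 f) x = partial e3 (partial e2 f) x" (is "?B = ?A")
proof (rule ccontr)
  assume neq: "?B \<noteq> ?A"
  define \<epsilon> where "\<epsilon> = \<bar>?B - ?A\<bar> / 2"
  have \<epsilon>: "\<epsilon> > 0" using neq by (simp add: \<epsilon>_def)
  have f': "\<And>y. y \<in> S \<Longrightarrow> f differentiable (at y)"
    "\<And>y. y \<in> S \<Longrightarrow> partial e2 f differentiable (at y)"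
    "\<And>y. y \<in> S \<Longrightarrow> partial e3 f differentiable (at y)"
    and c: "continuous_on S (partial e2 (partial e3 f))" "continuous_on S (partial e3 (partial e2 f))"
    using f by (auto simp: numeral_2_eq_2)
  obtain d0 where d0: "d0 > 0" "ball x d0 \<subseteq> S"
    using S open_contains_ball by blast
  obtain d1 where d1: "d1 > 0"
    "\<And>y. y \<in> S \<Longrightarrow> dist y x < d1 \<Longrightarrow> dist (partial e2 (partial e3 f) y) ?B < \<epsilon>"
    using c(1) S(2) \<epsilon> unfolding continuous_on_iff by blast
  obtain d2 where d2: "d2 > 0"
    "\<And>y. y \<in> S \<Longrightarrow> dist y x < d2 \<Longrightarrow> dist (partial e3 (partial e2 f) y) ?A < \<epsilon>"
    using c(2) S(2) \<epsilon> unfolding continuous_on_iff by blast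
  \<comment> \<open>The intermediate points lie within \<open>2 * h\<close> of \<open>x\<close>, so
    a third of the smallest radius suffices.\<close>
  define h where "h = min d0 (min d1 d2) / 3"
  have h: "h > 0" using d0 d1 d2 by (simp add: h_def)
  have near: "dist (x + s *\<^sub>R d + t *\<^sub>R e) x < 3 * h"
    if "0 \<le> s" "s \<le> h" "0 \<le> t" "t \<le> h" "norm d = 1" "norm e = 1" for s t d e
  proof -
    have "dist (x + s *\<^sub>R d + t *\<^sub>R e) x = norm (s *\<^sub>R d + t *\<^sub>R e)" by (simp add: dist_norm)
    also have "\<dots> \<le> norm (s *\<^sub>R d) + norm (t *\<^sub>R e)" by (rule norm_triangle_ineq)
    also have "\<dots> \<le> 2 * h" using that by simp
    finally show ?thesis using h by simp
  qed
  have nrm: "norm e2 = 1" "norm e3 = 1" by (simp_all add: e2_def e3_def norm_Pair)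
  have inS: "x + s *\<^sub>R d + t *\<^sub>R e \<in> S"
    if "0 \<le> s" "s \<le> h" "0 \<le> t" "t \<le> h" "norm d = 1" "norm e = 1" for s t d e
    using near[OF that] subsetD[OF d0(2)] by (simp add: h_def dist_commute)
  obtain s t where st: "0 \<le> s" "s \<le> h" "0 \<le> t" "t \<le> h"
    "f (x + h *\<^sub>R e2 + h *\<^sub>R e3) - f (x + h *\<^sub>R e2) - f (x + h *\<^sub>R e3) + f x
      = h\<^sup>2 * partial e3 (partial e2 f) (x + s *\<^sub>R e2 + t *\<^sub>R e3)"
    by (rule double_difference_mvt[OF h, of f x e2 e3]) (use f' inS nrm in auto)
  obtain s' t' where st': "0 \<le> s'" "s' \<le> h" "0 \<le> t'" "t' \<le> h"
    "f (x + h *\<^sub>R e3 + h *\<^sub>R e2) - f (x + h *\<^sub>R e3) - f (x + h *\<^sub>R e2) + f x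
      = h\<^sup>2 * partial e2 (partial e3 f) (x + s' *\<^sub>R e3 + t' *\<^sub>R e2)"
    by (rule double_difference_mvt[OF h, of f x e3 e2]) (use f' inS nrm in auto)
  have "x + h *\<^sub>R e2 + h *\<^sub>R e3 = x + h *\<^sub>R e3 + h *\<^sub>R e2" by simp
  then have swap: "f (x + h *\<^sub>R e2 + h *\<^sub>R e3) = f (x + h *\<^sub>R e3 + h *\<^sub>R e2)" by (rule arg_cong)
  have "h\<^sup>2 * partial e3 (partial e2 f) (x + s *\<^sub>R e2 + t *\<^sub>R e3)
      = h\<^sup>2 * partial e2 (partial e3 f) (x + s' *\<^sub>R e3 + t' *\<^sub>R e2)"
    using st(5) st'(5) swap by linarith
  then have eq: "partial e3 (partial e2 f) (x + s *\<^sub>R e2 + t *\<^sub>R e3)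
      = partial e2 (partial e3 f) (x + s' *\<^sub>R e3 + t' *\<^sub>R e2)"
    using h by simp
  have "dist (partial e3 (partial e2 f) (x + s *\<^sub>R e2 + t *\<^sub>R e3)) ?A < \<epsilon>"
    using d2(2)[OF inS[OF st(1-4) nrm]] near[OF st(1-4) nrm] by (simp add: h_def)
  moreover have "dist (partial e2 (partial e3 f) (x + s' *\<^sub>R e3 + t' *\<^sub>R e2)) ?B < \<epsilon>"
    using d1(2)[OF inS[OF st'(1-4) nrm(2,1)]] near[OF st'(1-4) nrm(2,1)] by (simp add: h_def)
  ultimately have "\<bar>?B - ?A\<bar> < 2 * \<epsilon>"
    using eq by (simp add: dist_real_def)
  then show False by (simp add: \<epsilon>_def)
qed

text \<open>\<open>v1\<close> and \<open>v2\<close> are the first and second derivative in direction \<open>d\<close>. The second one is required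
  only at \<open>x\<close> itself, which is all that the second-derivative test uses.\<close>

definition djet :: "(plane \<Rightarrow> real) \<Rightarrow> plane \<Rightarrow> plane \<Rightarrow> real \<Rightarrow> real \<Rightarrow> bool" where
  "djet f x d v1 v2 \<longleftrightarrow> (\<exists>g. g 0 = v1 \<and>
     (\<forall>\<^sub>F t in nhds 0. ((\<lambda>t. f (x + t *\<^sub>R d)) has_real_derivative g t) (at t)) \<and>
     (g has_real_derivative v2) (at 0))"

section \<open>Calculus of second-order jets along lines\<close>

lemma djet_DERIV:
  assumes "djet f x d v1 v2"
  shows "((\<lambda>t. f (x + t *\<^sub>R d)) has_real_derivative v1) (at 0)"
  using assms unfolding djet_def by (auto dest: eventually_nhds_x_imp_x)

lemma djet_const: "djet (\<lambda>_. c) x d 0 0"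
  unfolding djet_def by (rule exI[of _ "\<lambda>_. 0"]) auto

lemma djet_fst: "djet fst x d (fst d) 0"
  unfolding djet_def by (rule exI[of _ "\<lambda>_. fst d"]) (auto intro!: derivative_eq_intros always_eventually)

lemma djet_snd: "djet snd x d (snd d) 0"
  unfolding djet_def by (rule exI[of _ "\<lambda>_. snd d"]) (auto intro!: derivative_eq_intros always_eventually)

lemma djet_add:
  assumes "djet f x d v1 v2" "djet g x d w1 w2"
  shows "djet (\<lambda>y. f y + g y) x d (v1 + w1) (v2 + w2)"
proof -
  obtain f' g' where
    f: "f' 0 = v1" "\<forall>\<^sub>F t in nhds 0. ((\<lambda>t. f (x + t *\<^sub>R d)) has_real_derivative f' t) (at t)"
      "(f' has_real_derivative v2) (at 0)" and
    g: "g' 0 = w1" "\<forall>\<^sub>F t in nhds 0. ((\<lambda>t. g (x + t *\<^sub>R d)) has_real_derivative g' t) (at t)"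
      "(g' has_real_derivative w2) (at 0)"
    using assms unfolding djet_def by auto
  have "\<forall>\<^sub>F t in nhds 0. ((\<lambda>t. f (x + t *\<^sub>R d) + g (x + t *\<^sub>R d)) has_real_derivative f' t + g' t) (at t)"
    using f(2) g(2) by eventually_elim (rule DERIV_add)
  then show ?thesis
    unfolding djet_def using f(1,3) g(1,3)
    by (intro exI[of _ "\<lambda>t. f' t + g' t"]) (auto intro: DERIV_add)
qed

lemma djet_mult:
  assumes "djet f x d v1 v2" "djet g x d w1 w2"
  shows "djet (\<lambda>y. f y * g y) x d (v1 * g x + f x * w1) (v2 * g x + 2 * v1 * w1 + f x * w2)"
proof -
  obtain f' g' where
    f: "f' 0 = v1" "\<forall>\<^sub>F t in nhds 0. ((\<lambda>t. f (x + t *\<^sub>R d)) has_real_derivative f' t) (at t)"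
      "(f' has_real_derivative v2) (at 0)" and
    g: "g' 0 = w1" "\<forall>\<^sub>F t in nhds 0. ((\<lambda>t. g (x + t *\<^sub>R d)) has_real_derivative g' t) (at t)"
      "(g' has_real_derivative w2) (at 0)"
    using assms unfolding djet_def by auto
  let ?k = "\<lambda>t. f' t * g (x + t *\<^sub>R d) + f (x + t *\<^sub>R d) * g' t"
  have "\<forall>\<^sub>F t in nhds 0. ((\<lambda>t. f (x + t *\<^sub>R d) * g (x + t *\<^sub>R d)) has_real_derivative ?k t) (at t)"
    using f(2) g(2) by eventually_elim (auto intro!: derivative_eq_intros)
  moreover have "(?k has_real_derivative v2 * g x + 2 * v1 * w1 + f x * w2) (at 0)"
    using f(1,3) g(1,3) djet_DERIV[OF assms(1)] djet_DERIV[OF assms(2)]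
    by (auto intro!: derivative_eq_intros)
  ultimately show ?thesis
    unfolding djet_def using f(1) g(1)
    by (intro exI[of _ ?k]) auto
qed

lemma djet_exp:
  assumes "djet f x d v1 v2"
  shows "djet (\<lambda>y. exp (f y)) x d (exp (f x) * v1) (exp (f x) * (v2 + v1\<^sup>2))"
proof -
  obtain f' where
    f: "f' 0 = v1" "\<forall>\<^sub>F t in nhds 0. ((\<lambda>t. f (x + t *\<^sub>R d)) has_real_derivative f' t) (at t)"
      "(f' has_real_derivative v2) (at 0)"
    using assms unfolding djet_def by auto
  let ?k = "\<lambda>t. exp (f (x + t *\<^sub>R d)) * f' t"
  have "\<forall>\<^sub>F t in nhds 0. ((\<lambda>t. exp (f (x + t *\<^sub>R d))) has_real_derivative ?k t) (at t)"
    using f(2) by eventually_elim (auto intro!: derivative_eq_intros)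
  moreover have "(?k has_real_derivative exp (f x) * (v2 + v1\<^sup>2)) (at 0)"
    using f(1,3) djet_DERIV[OF assms]
    by (auto intro!: derivative_eq_intros simp: algebra_simps power2_eq_square)
  ultimately show ?thesis
    unfolding djet_def using f(1) by (intro exI[of _ ?k]) auto
qed

text \<open>Lets a jet be assembled with the calculus rules and then be restated with simplified
  values.\<close>

lemma djet_cong:
  assumes "djet f x d v1 v2" "\<And>y. g y = f y" "w1 = v1" "w2 = v2"
  shows "djet g x d w1 w2"
proof -
  have "g = f" using assms(2) by auto
  then show ?thesis using assms by simp
qed

lemma djet_cmult:
  assumes "djet f x d v1 v2"
  shows "djet (\<lambda>y. c * f y) x d (c * v1) (c * v2)"
  by (rule djet_cong[OF djet_mult[OF djet_const[of c] assms]]) auto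

lemma djet_power2:
  assumes "djet f x d v1 v2"
  shows "djet (\<lambda>y. (f y)\<^sup>2) x d (2 * f x * v1) (2 * v1\<^sup>2 + 2 * f x * v2)"
  by (rule djet_cong[OF djet_mult[OF assms assms]]) (auto simp: power2_eq_square algebra_simps)

lemma eventually_line:
  fixes x d :: plane
  assumes "\<forall>\<^sub>F y in nhds x. P y"
  shows "\<forall>\<^sub>F t in nhds 0. P (x + t *\<^sub>R d)"
proof -
  have "((\<lambda>t::real. x + t *\<^sub>R d) \<longlongrightarrow> x + 0 *\<^sub>R d) (nhds 0)"
    by (intro tendsto_intros filterlim_ident)
  then have "filterlim (\<lambda>t::real. x + t *\<^sub>R d) (nhds x) (nhds 0)" by simp
  then show ?thesis using assms unfolding filterlim_iff by blast
qed

text \<open>The chain rule along the line, applied twice; symmetry of the second derivatives merges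
  the two mixed terms.\<close>

lemma djet_Ck:
  assumes S: "open S" "x \<in> S" and f: "Ck_on 2 S f"
  shows "djet f x d (fst d * partial e2 f x + snd d * partial e3 f x)
     ((fst d)\<^sup>2 * partial e2 (partial e2 f) x + 2 * fst d * snd d * partial e3 (partial e2 f) x
       + (snd d)\<^sup>2 * partial e3 (partial e3 f) x)"
proof -
  have f': "\<And>y. y \<in> S \<Longrightarrow> f differentiable (at y)"
    "\<And>y. y \<in> S \<Longrightarrow> partial e2 f differentiable (at y)"
    "\<And>y. y \<in> S \<Longrightarrow> partial e3 f differentiable (at y)"
    using f by (auto simp: numeral_2_eq_2)
  let ?k = "\<lambda>t. fst d * partial e2 f (x + t *\<^sub>R d) + snd d * partial e3 f (x + t *\<^sub>R d)"
  have "\<forall>\<^sub>F t in nhds 0. x + t *\<^sub>R d \<in> S"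
    using eventually_line[of "\<lambda>y. y \<in> S"] S by (simp add: eventually_nhds_in_open)
  then have "\<forall>\<^sub>F t in nhds 0. ((\<lambda>t. f (x + t *\<^sub>R d)) has_real_derivative ?k t) (at t)"
  proof eventually_elim
    case (elim t)
    show ?case
      using has_real_derivative_along_line[OF f'(1)[OF elim]]
      unfolding partial_decomp[OF f'(1)[OF elim], of d] .
  qed
  moreover have "(?k has_real_derivative
     fst d * partial d (partial e2 f) (x + 0 *\<^sub>R d) + snd d * partial d (partial e3 f) (x + 0 *\<^sub>R d)) (at 0)"
    by (intro DERIV_add DERIV_cmult has_real_derivative_along_line) (use f' S in auto)
  then have "(?k has_real_derivative (fst d)\<^sup>2 * partial e2 (partial e2 f) x + 2 * fst d * snd d * partial e3 (partial e2 f) x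
       + (snd d)\<^sup>2 * partial e3 (partial e3 f) x) (at 0)"
    using partial_decomp[OF f'(2)[OF S(2)], of d] partial_decomp[OF f'(3)[OF S(2)], of d]
      partial_commute[OF S f]
    by (simp add: algebra_simps power2_eq_square)
  ultimately show ?thesis
    unfolding djet_def by (intro exI[of _ ?k]) auto
qed

text \<open>Restricted to the line, \<open>f\<close> has a local maximum at \<open>0\<close>. If
  \<open>v2\<close> were positive, the first derivative would be positive just to the right of
  \<open>0\<close> and \<open>f\<close> would increase there.\<close>

lemma djet_local_max:
  assumes j: "djet f x d v1 v2" and m: "\<forall>\<^sub>F y in nhds x. f y \<le> f x"
  shows "v1 = 0" "v2 \<le> 0"
proof -
  let ?f = "\<lambda>t. f (x + t *\<^sub>R d)"
  obtain g where g: "g 0 = v1" "\<forall>\<^sub>F t in nhds 0. (?f has_real_derivative g t) (at t)"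
      "(g has_real_derivative v2) (at 0)"
    using j unfolding djet_def by auto
  obtain \<delta> where \<delta>: "\<delta> > 0" "\<And>t. \<bar>t\<bar> < \<delta> \<Longrightarrow> ?f t \<le> f x \<and> (?f has_real_derivative g t) (at t)"
    using eventually_conj[OF eventually_line[OF m, of d] g(2)]
    unfolding eventually_nhds_metric by (auto simp: dist_real_def)
  show v1: "v1 = 0"
    using DERIV_local_max[OF djet_DERIV[OF j] \<delta>(1)] \<delta>(2) by simp
  show "v2 \<le> 0"
  proof (rule ccontr)
    assume "\<not> v2 \<le> 0"
    then obtain e where e: "e > 0" "\<And>h. h > 0 \<Longrightarrow> h < e \<Longrightarrow> g 0 < g (0 + h)"
      using DERIV_pos_inc_right[OF g(3)] by force
    define h where "h = min \<delta> e / 2"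
    have h: "h > 0" "h < \<delta>" "h < e" using \<delta> e by (auto simp: h_def)
    obtain z where z: "0 < z" "z < h" "?f h - ?f 0 = (h - 0) * g z"
      using MVT2[OF h(1), of ?f g] \<delta>(2) h by force
    have "g z > 0" using e(2)[of z] z h g(1) v1 by simp
    then have "?f h > ?f 0" using z h by (simp add: algebra_simps)
    then show False using \<delta>(2)[of h] h by simp
  qed
qed

section \<open>The soliton equation and the gradient function\<close>

lemma partial_cong:
  assumes "open S" "x \<in> S" "\<And>y. y \<in> S \<Longrightarrow> f y = g y"
  shows "partial d f x = partial d g x"
proof -
  have "(f has_derivative D) (at x) \<longleftrightarrow> (g has_derivative D) (at x)" for D
    using has_derivative_transform_within_open[of f D x UNIV S g]
      has_derivative_transform_within_open[of g D x UNIV S f] assms by auto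
  then show ?thesis by (simp add: partial_def frechet_derivative_def)
qed

lemma smooth_on_imp:
  assumes "smooth_on S f"
  shows "Ck_on k S f" "smooth_on S (partial e2 f)" "smooth_on S (partial e3 f)"
    "\<And>x. x \<in> S \<Longrightarrow> f differentiable (at x)"
proof -
  have "Ck_on (Suc k) S f" for k using assms by (simp add: smooth_on_def)
  then show "Ck_on k S f" "smooth_on S (partial e2 f)" "smooth_on S (partial e3 f)"
    "\<And>x. x \<in> S \<Longrightarrow> f differentiable (at x)"
    using assms by (auto simp: smooth_on_def)
qed

text \<open>Serves to expand the divergence: with \<open>(a, b)\<close> the gradient and
  \<open>f\<close> one of its components, the function is a component of the normalized gradient.
  The cube of \<open>q\<close> comes from differentiating the inverse square root.\<close>

lemma partial_sum_squares_normalized: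
  fixes a b :: "plane \<Rightarrow> real"
  assumes a: "a differentiable (at x)" and b: "b differentiable (at x)" and f: "f differentiable (at x)"
  defines "q \<equiv> inverse (sqrt (1 + (a x)\<^sup>2 + (b x)\<^sup>2))"
  shows "partial d (\<lambda>y. inverse (sqrt (1 + (a y)\<^sup>2 + (b y)\<^sup>2)) * f y) x
    = q * partial d f x - q ^ 3 * (a x * partial d a x + b x * partial d b x) * f x"
proof -
  let ?W = "\<lambda>y. 1 + (a y)\<^sup>2 + (b y)\<^sup>2"
  obtain A B F where D: "(a has_derivative A) (at x)" "(b has_derivative B) (at x)" "(f has_derivative F) (at x)"
    using a b f unfolding differentiable_def by blast
  have pos: "?W x > 0" by (simp add: add_pos_nonneg)
  have W: "(?W has_derivative (\<lambda>h. 2 * a x * A h + 2 * b x * B h)) (at x)"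
    by (auto intro!: derivative_eq_intros D)
  have "((\<lambda>w. inverse (sqrt w)) has_real_derivative - (q ^ 3) / 2) (at (?W x))"
    using pos by (auto intro!: derivative_eq_intros simp: q_def power3_eq_cube field_simps)
  then have "((\<lambda>w. inverse (sqrt w)) has_derivative (*) (- (q ^ 3) / 2)) (at (?W x))"
    by (simp add: has_field_derivative_def)
  from diff_chain_at[OF W this]
  moreover have "(*) (- (q ^ 3) / 2) \<circ> (\<lambda>h. 2 * a x * A h + 2 * b x * B h)
      = (\<lambda>h. - (q ^ 3) * (a x * A h + b x * B h))"
    by (auto simp: algebra_simps)
  ultimately have "((\<lambda>y. inverse (sqrt (?W y))) has_derivative
      (\<lambda>h. - (q ^ 3) * (a x * A h + b x * B h))) (at x)"
    by (simp add: o_def)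
  from has_derivative_mult[OF this D(3)]
  have "((\<lambda>y. inverse (sqrt (?W y)) * f y) has_derivative
      (\<lambda>h. q * F h - q ^ 3 * (a x * A h + b x * B h) * f x)) (at x)"
    by (simp add: q_def algebra_simps)
  from partialI[OF this, of d] show ?thesis
    using partialI[OF D(1), of d] partialI[OF D(2), of d] partialI[OF D(3), of d] by simp
qed

lemma translating_soliton_nondivergence:
  assumes S: "open \<Omega>" "x \<in> \<Omega>" and u: "translating_soliton_on \<Omega> u"
  defines "a \<equiv> partial e2 u x" and "b \<equiv> partial e3 u x"
  shows "(1 + b\<^sup>2) * partial e2 (partial e2 u) x - 2 * a * b * partial e3 (partial e2 u) x
     + (1 + a\<^sup>2) * partial e3 (partial e3 u) x + b * (1 + a\<^sup>2 + b\<^sup>2) = 0"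
proof -
  have sm: "smooth_on \<Omega> u" using u by (simp add: translating_soliton_on_def)
  let ?a = "partial e2 u" and ?b = "partial e3 u"
  define q where "q = inverse (sqrt (1 + a\<^sup>2 + b\<^sup>2))"
  have pos: "1 + a\<^sup>2 + b\<^sup>2 > 0" by (simp add: add_pos_nonneg)
  have dab: "?a differentiable (at x)" "?b differentiable (at x)"
    using smooth_on_imp[OF sm] smooth_on_imp(4) S by auto
  have ng: "(norm (grad u y))\<^sup>2 = (?a y)\<^sup>2 + (?b y)\<^sup>2" for y
    by (simp add: grad_def norm_Pair)
  have "divergence (\<lambda>y. grad u y /\<^sub>R sqrt (1 + (norm (grad u y))\<^sup>2)) x
     = partial e2 (\<lambda>y. inverse (sqrt (1 + (?a y)\<^sup>2 + (?b y)\<^sup>2)) * ?a y) x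
     + partial e3 (\<lambda>y. inverse (sqrt (1 + (?a y)\<^sup>2 + (?b y)\<^sup>2)) * ?b y) x"
    by (simp add: divergence_def ng add.assoc) (simp add: grad_def)
  also have "\<dots> = q * partial e2 ?a x - q ^ 3 * (a * partial e2 ?a x + b * partial e2 ?b x) * a
    + (q * partial e3 ?b x - q ^ 3 * (a * partial e3 ?a x + b * partial e3 ?b x) * b)"
    unfolding partial_sum_squares_normalized[OF dab dab(1)] partial_sum_squares_normalized[OF dab dab(2)]
    by (simp add: a_def b_def q_def)
  finally have "q * partial e2 ?a x - q ^ 3 * (a * partial e2 ?a x + b * partial e2 ?b x) * a
    + (q * partial e3 ?b x - q ^ 3 * (a * partial e3 ?a x + b * partial e3 ?b x) * b) = - (b * q)"
    using u S unfolding translating_soliton_on_def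
    by (simp add: ng q_def a_def b_def add.assoc divide_inverse)
  moreover have "partial e2 ?b x = partial e3 ?a x"
    by (rule partial_commute[OF S smooth_on_imp(1)[OF sm]])
  moreover have "q \<noteq> 0" "q ^ 2 * (1 + a\<^sup>2 + b\<^sup>2) = 1"
    using pos by (auto simp: q_def power_inverse)
  \<comment> \<open>Every term carries \<open>q\<close> or \<open>q ^ 3\<close>; the relation
    between \<open>q ^ 2\<close> and \<open>1 + a\<^sup>2 + b\<^sup>2\<close> allows a division by
    \<open>q ^ 3\<close>.\<close>
  ultimately show ?thesis by algebra
qed

text \<open>Here \<open>(a, b)\<close> is the gradient of the soliton, \<open>r, s, t\<close> are its second and \<open>r2, r3, s3, t3\<close> its third
  derivatives, \<open>E\<close> is the equation and \<open>E2\<close>, \<open>E3\<close> its two derivatives. In geometric terms the identity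
  is \<open>L (log w) = 2 |A|\<^sup>2 + |\<nabla> log w|\<^sup>2 / 2\<close> for the drift Laplacian \<open>L\<close> of the graph, the right-hand
  side collecting the part of the second fundamental form not controlled by \<open>\<nabla>w\<close>. In the frame
  of the gradient direction, its two squares are the mixed and the tangential second derivative.\<close>

lemma norm_grad_jet_identity:
  fixes a b r s t r2 r3 s3 t3 :: real
  defines "w \<equiv> 1 + a\<^sup>2 + b\<^sup>2" and "h \<equiv> a\<^sup>2 + b\<^sup>2"
    and "H2 \<equiv> 2 * (a * r + b * s)" and "H3 \<equiv> 2 * (a * s + b * t)"
  assumes E: "(1 + b\<^sup>2) * r - 2 * a * b * s + (1 + a\<^sup>2) * t + b * w = 0"
    and E2: "2 * b * s * r + (1 + b\<^sup>2) * r2 - 2 * (r * b * s + a * s * s + a * b * r3) + 2 * a * r * t + (1 + a\<^sup>2) * s3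
      + s * w + b * H2 = 0"
    and E3: "2 * b * t * r + (1 + b\<^sup>2) * r3 - 2 * (s * b * s + a * t * s + a * b * s3) + 2 * a * s * t + (1 + a\<^sup>2) * t3
      + t * w + b * H3 = 0"
    and Q: "Q = 2 * (r\<^sup>2 + 2 * s\<^sup>2 + t\<^sup>2 + (b * r-a * s)\<^sup>2 + (b * s-a * t)\<^sup>2)
      + 2 * a * ((1 + b\<^sup>2) * r2 - 2 * a * b * r3 + (1 + a\<^sup>2) * s3)
      + 2 * b * ((1 + b\<^sup>2) * r3 - 2 * a * b * s3 + (1 + a\<^sup>2) * t3) + w * H3"
  shows "h * (2 * w * h * Q - (3 * w - 2) * (H2\<^sup>2 + H3\<^sup>2 + (b * H2 - a * H3)\<^sup>2))
      = 4 * w * ((-a * b * r + (a\<^sup>2 - b\<^sup>2) * s + a * b * t)\<^sup>2 + w * (b\<^sup>2 * r - 2 * a * b * s + a\<^sup>2 * t)\<^sup>2)"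
proof -
  let ?E0 = "(1 + b\<^sup>2) * r - 2 * a * b * s + (1 + a\<^sup>2) * t"
  let ?P = "2 * (r\<^sup>2 + 2 * s\<^sup>2 + t\<^sup>2 + (b * r-a * s)\<^sup>2 + (b * s-a * t)\<^sup>2)
    - 2 * a * (2 * b * s * r - 2 * (r * b * s + a * s * s) + 2 * a * r * t) - 2 * b * (2 * b * t * r - 2 * (s * b * s + a * t * s) + 2 * a * s * t)"
  \<comment> \<open>Third derivatives enter \<open>Q\<close> only through the principal part applied
    to \<open>a\<close> and to \<open>b\<close>, which the differentiated equations express by lower
    derivatives. The drift term \<open>w * H3\<close> then cancels.\<close>
  have X: "(1 + b\<^sup>2) * r2 - 2 * a * b * r3 + (1 + a\<^sup>2) * s3
      = - (2 * b * s * r - 2 * (r * b * s + a * s * s) + 2 * a * r * t + s * w + b * H2)"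
    using E2 by algebra
  have Y: "(1 + b\<^sup>2) * r3 - 2 * a * b * s3 + (1 + a\<^sup>2) * t3
      = - (2 * b * t * r - 2 * (s * b * s + a * t * s) + 2 * a * s * t + t * w + b * H3)"
    using E3 by algebra
  have "Q = ?P - 2 * b * (a * H2 + b * H3)"
    unfolding Q X Y H3_def by algebra
  \<comment> \<open>The equation itself trades the remaining factor \<open>b * w\<close> for second
    derivatives. After that both sides are quadratic in \<open>r\<close>, \<open>s\<close>,
    \<open>t\<close>, and the claim is a polynomial identity.\<close>
  moreover have bw: "b * w = - ?E0" using E by simp
  ultimately have wQ: "w * Q = w * ?P + 2 * ?E0 * (a * H2 + b * H3)" by algebra
  have "h * (2 * w * h * Q - (3 * w - 2) * (H2\<^sup>2 + H3\<^sup>2 + (b * H2 - a * H3)\<^sup>2))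
     = h * (2 * h * (w * Q) - (3 * w - 2) * (H2\<^sup>2 + H3\<^sup>2 + (b * H2 - a * H3)\<^sup>2))"
    by (simp add: mult_ac)
  also have "\<dots> = 4 * w * ((-a * b * r + (a\<^sup>2 - b\<^sup>2) * s + a * b * t)\<^sup>2 + w * (b\<^sup>2 * r - 2 * a * b * s + a\<^sup>2 * t)\<^sup>2)"
    unfolding wQ unfolding w_def h_def H2_def H3_def by algebra
  finally show ?thesis .
qed

text \<open>Since the principal part of the equation is \<open>\<partial>\<^sub>2\<^sup>2 + \<partial>\<^sub>3\<^sup>2 + \<partial>\<^sub>n\<^sup>2\<close> with \<open>n = (b, -a)\<close>, the operator
  \<open>w L\<close> at a fixed point is the sum of the second derivatives along \<open>e2\<close>, \<open>e3\<close> and \<open>n\<close>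
  plus \<open>w \<partial>\<^sub>3\<close>.\<close>

lemma soliton_jets:
  assumes S: "open \<Omega>" "x \<in> \<Omega>" and u: "translating_soliton_on \<Omega> u"
  defines "a \<equiv> partial e2 u x" and "b \<equiv> partial e3 u x" and "h \<equiv> \<lambda>y. (norm (grad u y))\<^sup>2"
  obtains U H V where
    "\<And>d. djet u x d (fst d * a + snd d * b) (U d)"
    "U e2 + U e3 + U (b, -a) + (1 + h x) * b = 0"
    "\<And>d. djet h x d (H d) (V d)"
    "H (b, -a) = b * H e2 - a * H e3"
    "(3 * h x + 1) * ((H e2)\<^sup>2 + (H e3)\<^sup>2 + (H (b, -a))\<^sup>2)
       \<le> 2 * (1 + h x) * h x * (V e2 + V e3 + V (b, -a) + (1 + h x) * H e3)"
proof -
  let ?a = "partial e2 u" and ?b = "partial e3 u"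
  let ?r = "partial e2 ?a" and ?s = "partial e3 ?a" and ?t = "partial e3 ?b"
  define r s t where "r = ?r x" and "s = ?s x" and "t = ?t x"
  define r2 r3 s3 t3 where "r2 = partial e2 ?r x" and "r3 = partial e3 ?r x"
    and "s3 = partial e3 ?s x" and "t3 = partial e3 ?t x"
  have sm: "smooth_on \<Omega> u" using u by (simp add: translating_soliton_on_def)
  note sma = smooth_on_imp(2)[OF sm] and smb = smooth_on_imp(3)[OF sm]
  note smr = smooth_on_imp(2)[OF sma] and sms = smooth_on_imp(3)[OF sma] and smt = smooth_on_imp(3)[OF smb]
  \<comment> \<open>Stated on all of \<Omega>, because it is differentiated once more to exchange
    third derivatives.\<close>
  have b2: "partial e2 ?b y = ?s y" if "y \<in> \<Omega>" for y
    by (rule partial_commute[OF S(1) that smooth_on_imp(1)[OF sm]])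
  have s2: "partial e2 ?s x = r3"
    unfolding r3_def by (rule partial_commute[OF S smooth_on_imp(1)[OF sma]])
  have t2: "partial e2 ?t x = s3"
    using partial_commute[OF S smooth_on_imp(1)[OF smb]] partial_cong[OF S b2]
    by (simp add: s3_def)
  have b22: "partial e2 (partial e2 ?b) x = r3" "partial e3 (partial e2 ?b) x = s3"
    using partial_cong[OF S b2] s2 by (simp_all add: s3_def)
  have hx: "h y = (?a y)\<^sup>2 + (?b y)\<^sup>2" for y by (simp add: h_def grad_def norm_Pair)
  let ?w = "1 + a\<^sup>2 + b\<^sup>2"
  have E: "(1 + b\<^sup>2) * r - 2 * a * b * s + (1 + a\<^sup>2) * t + b * ?w = 0"
    using translating_soliton_nondivergence[OF S u] by (simp add: a_def b_def r_def s_def t_def)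
  \<comment> \<open>The soliton equation differentiated in direction \<open>d\<close>: its left-hand
    side vanishes along the line near \<open>x\<close>.\<close>
  have dE: "2 * b * bd * r + (1 + b\<^sup>2) * rd - 2 * (ad * b * s + a * bd * s + a * b * sd) + 2 * a * ad * t + (1 + a\<^sup>2) * td
      + bd*?w + b * (2 * a * ad + 2 * b * bd) = 0"
    if "ad = partial d ?a x" "bd = partial d ?b x" "rd = partial d ?r x" "sd = partial d ?s x"
      "td = partial d ?t x" for d ad bd rd sd td
  proof -
    let ?L = "\<lambda>f t. f (x + t *\<^sub>R d)"
    have ln: "(?L f has_real_derivative partial d f x) (at 0)" if "smooth_on \<Omega> f" for f
      using has_real_derivative_along_line[of f x 0 d] smooth_on_imp(4)[OF that S(2)] by simp
    let ?F = "\<lambda>z. (1 + (?L ?b z)\<^sup>2) * ?L ?r z - 2 * ?L ?a z * ?L ?b z * ?L ?s z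
       + (1 + (?L ?a z)\<^sup>2) * ?L ?t z + ?L ?b z * (1 + (?L ?a z)\<^sup>2 + (?L ?b z)\<^sup>2)"
    have "\<forall>\<^sub>F z in nhds 0. x + z *\<^sub>R d \<in> \<Omega>"
      using eventually_line[of "\<lambda>y. y \<in> \<Omega>"] S by (simp add: eventually_nhds_in_open)
    then have ev: "\<forall>\<^sub>F z in nhds 0. ?F z = 0"
      by eventually_elim (rule translating_soliton_nondivergence[OF S(1) _ u])
    have "(?F has_real_derivative 0) (at 0)"
      using DERIV_cong_ev[OF refl ev refl] by simp
    moreover have "(?F has_real_derivative
       2 * b * bd * r + (1 + b\<^sup>2) * rd - 2 * (ad * b * s + a * bd * s + a * b * sd) + 2 * a * ad * t + (1 + a\<^sup>2) * td
      + bd*?w + b * (2 * a * ad + 2 * b * bd)) (at 0)"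
      unfolding that
      by (rule derivative_eq_intros ln sma smb smr sms smt refl)+
        (simp add: a_def b_def r_def s_def t_def algebra_simps)
    ultimately show ?thesis using DERIV_unique by blast
  qed
  have E2: "2 * b * s * r + (1 + b\<^sup>2) * r2 - 2 * (r * b * s + a * s * s + a * b * r3) + 2 * a * r * t + (1 + a\<^sup>2) * s3
      + s*?w + b * (2 * (a * r + b * s)) = 0"
    using dE[of r e2 s r2 r3 s3] b2[OF S(2)] s2 t2
    by (simp add: r_def s_def r2_def algebra_simps)
  have E3: "2 * b * t * r + (1 + b\<^sup>2) * r3 - 2 * (s * b * s + a * t * s + a * b * s3) + 2 * a * s * t + (1 + a\<^sup>2) * t3
      + t*?w + b * (2 * (a * s + b * t)) = 0"
    using dE[of s e3 t r3 s3 t3]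
    by (simp add: s_def t_def r3_def s3_def t3_def algebra_simps)
  \<comment> \<open>\<open>U\<close> is the second derivative of \<open>u\<close> along
    \<open>d\<close>; \<open>A1\<close>, \<open>A2\<close> are the jet of the first gradient
    component, \<open>B1\<close>, \<open>B2\<close> that of the second, and \<open>H\<close>,
    \<open>V\<close> that of the squared norm of the gradient.\<close>
  define U where "U d = (fst d)\<^sup>2 * r + 2 * fst d * snd d * s + (snd d)\<^sup>2 * t" for d
  define A1 where "A1 d = fst d * r + snd d * s" for d
  define B1 where "B1 d = fst d * s + snd d * t" for d
  define A2 where "A2 d = (fst d)\<^sup>2 * r2 + 2 * fst d * snd d * r3 + (snd d)\<^sup>2 * s3" for d
  define B2 where "B2 d = (fst d)\<^sup>2 * r3 + 2 * fst d * snd d * s3 + (snd d)\<^sup>2 * t3" for d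
  define H where "H d = 2 * a * A1 d + 2 * b * B1 d" for d
  define V where "V d = 2 * (A1 d)\<^sup>2 + 2 * a * A2 d + (2 * (B1 d)\<^sup>2 + 2 * b * B2 d)" for d
  have ju: "djet u x d (fst d * a + snd d * b) (U d)" for d
    using djet_Ck[OF S smooth_on_imp(1)[OF sm], of d]
    by (simp add: U_def a_def b_def r_def s_def t_def)
  have ja: "djet ?a x d (A1 d) (A2 d)" for d
    using djet_Ck[OF S smooth_on_imp(1)[OF sma], of d]
    by (simp add: A1_def A2_def r_def s_def r2_def r3_def s3_def)
  have jb: "djet ?b x d (B1 d) (B2 d)" for d
    using djet_Ck[OF S smooth_on_imp(1)[OF smb], of d] b2[OF S(2)] b22
    by (simp add: B1_def B2_def s_def t_def t3_def)
  have jh: "djet h x d (H d) (V d)" for d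
    by (rule djet_cong[OF djet_add[OF djet_power2[OF ja] djet_power2[OF jb]]])
      (auto simp: hx H_def V_def a_def b_def)
  have hw: "h x = a\<^sup>2 + b\<^sup>2" by (simp add: hx a_def b_def)
  have e23: "fst e2 = 1" "snd e2 = 0" "fst e3 = 0" "snd e3 = 1" by (simp_all add: e2_def e3_def)
  have Ueq: "U e2 + U e3 + U (b, -a) + (1 + h x) * b = 0"
    using E by (simp add: U_def e23 hw algebra_simps power2_eq_square)
  have Hn: "H (b, -a) = b * H e2 - a * H e3"
    by (simp add: H_def A1_def B1_def e23 algebra_simps)
  define Q where "Q = V e2 + V e3 + V (b, -a) + (1 + h x) * H e3"
  define Z where "Z = (H e2)\<^sup>2 + (H e3)\<^sup>2 + (H (b, -a))\<^sup>2"
  have Hv: "H e2 = 2 * (a * r + b * s)" "H e3 = 2 * (a * s + b * t)"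
    by (simp_all add: H_def A1_def B1_def e23)
  have Q: "Q = 2 * (r\<^sup>2 + 2 * s\<^sup>2 + t\<^sup>2 + (b * r-a * s)\<^sup>2 + (b * s-a * t)\<^sup>2)
      + 2 * a * ((1 + b\<^sup>2) * r2 - 2 * a * b * r3 + (1 + a\<^sup>2) * s3)
      + 2 * b * ((1 + b\<^sup>2) * r3 - 2 * a * b * s3 + (1 + a\<^sup>2) * t3) + ?w * (2 * (a * s + b * t))"
    unfolding Q_def Hv hw
    by (simp add: V_def A1_def B1_def A2_def B2_def e23 algebra_simps)
  have id: "(a\<^sup>2 + b\<^sup>2) * (2 * ?w * (a\<^sup>2 + b\<^sup>2) * Q - (3 * ?w - 2) * Z)
      = 4 * ?w * ((-a * b * r + (a\<^sup>2 - b\<^sup>2) * s + a * b * t)\<^sup>2 + ?w * (b\<^sup>2 * r - 2 * a * b * s + a\<^sup>2 * t)\<^sup>2)"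
    using norm_grad_jet_identity[OF E E2 E3 Q] by (simp add: Z_def Hn Hv)
  have "(3 * h x + 1) * Z \<le> 2 * (1 + h x) * h x * Q"
  \<comment> \<open>The identity carries a factor \<open>h x\<close>. Where the gradient vanishes,
    so does \<open>H\<close>, and both sides are zero.\<close>
  proof (cases "h x = 0")
    case True
    then have "a = 0" "b = 0" using hw by (simp_all add: sum_power2_eq_zero_iff)
    then show ?thesis by (simp add: hw Z_def H_def)
  next
    case False
    then have hp: "h x > 0" using hw by (metis h_def less_eq_real_def zero_le_power2)
    have wp: "?w > 0" using hw hp by linarith
    have "0 \<le> h x * (2 * (1 + h x) * h x * Q - (3 * (1 + h x) - 2) * Z)"
      using id wp unfolding hw by (simp add: add.assoc)
    then have "0 \<le> 2 * (1 + h x) * h x * Q - (3 * (1 + h x) - 2) * Z"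
      using hp by (simp add: zero_le_mult_iff)
    then show ?thesis by (simp add: algebra_simps)
  qed
  then show thesis
    using that[of U H V] ju Ueq jh Hn by (simp add: Q_def Z_def)
qed

section \<open>Gradient estimates on upward sausages\<close>

text \<open>Downwards the cutoff drops over a length of order \<open>R\<close>, where its positive \<open>\<partial>\<^sub>3\<close>-derivative has
  the good sign for \<open>L\<close>; upwards \<open>\<partial>\<^sub>3\<close> has the bad sign, which forces the slow decay over a length
  of order \<open>R\<^sup>2\<close> and hence the shape of the sausage.\<close>

definition cutoff :: "plane \<Rightarrow> real \<Rightarrow> plane \<Rightarrow> real" where
  "cutoff p R x = 3 - 2 * exp (-6 * (snd x - snd p) / R) - 3 * (snd x - snd p) / R\<^sup>2
     - 3 * (fst x - fst p)\<^sup>2 / R\<^sup>2"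

lemma cutoff_center: "cutoff p R p = 1"
  by (simp add: cutoff_def)

lemma continuous_on_cutoff: "continuous_on S (cutoff p R)"
  unfolding cutoff_def by (auto intro!: continuous_intros simp: divide_inverse)

text \<open>Below \<open>p\<close>, a quadratic lower bound for the exponential confines the region
  to an ellipse inside the ball. Above \<open>p\<close>, each of the two polynomial terms stays
  below 3, so the point lies in the ball translated upwards by \<open>s\<close>.\<close>

lemma cutoff_nonneg:
  assumes R: "R \<ge> 1 / 4" and x: "cutoff p R x \<ge> 0"
  shows "x \<in> upward_sausage R p" "\<bar>fst x - fst p\<bar> \<le> R" "- (R / 6) \<le> snd x - snd p"
    "snd x - snd p \<le> R\<^sup>2" "cutoff p R x \<le> 3"
proof -
  define s where "s = snd x - snd p"
  define y where "y = fst x - fst p"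
  have Rp: "R > 0" "R\<^sup>2 > 0" using R by auto
  have c: "cutoff p R x = 3 - 2 * exp (-6 * s / R) - 3 * s / R\<^sup>2 - 3 * y\<^sup>2 / R\<^sup>2"
    by (simp add: cutoff_def s_def y_def)
  have xpy: "x = (fst p + y, snd p + s)" by (simp add: s_def y_def)
  have "x \<in> upward_sausage R p \<and> \<bar>y\<bar> \<le> R \<and> - (R / 6) \<le> s \<and> s \<le> R\<^sup>2 \<and> cutoff p R x \<le> 3"
  proof (cases "s < 0")
    case True
    define \<sigma> where "\<sigma> = - s / R"
    have \<sigma>: "\<sigma> > 0" "s = - \<sigma> * R" using True Rp by (auto simp: \<sigma>_def divide_neg_pos)
    have "1 + 6 * \<sigma> + (6 * \<sigma>)\<^sup>2 / 2 \<le> exp (6 * \<sigma>)"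
      using exp_lower_Taylor_quadratic[of "6 * \<sigma>"] \<sigma> by simp
    then have e: "exp (-6 * s / R) \<ge> 1 + 6 * \<sigma> + 18 * \<sigma>\<^sup>2"
      by (simp add: \<sigma>_def power_divide)
    \<comment> \<open>The rate 6 in the exponential and the bound on \<open>R\<close> are matched:
      the linear term is at most \<open>12 * \<sigma>\<close>, which the first-order part of the
      exponential cancels.\<close>
    have "1 / R \<le> 4" using R by (simp add: divide_le_eq)
    then have "- (3 * s / R\<^sup>2) \<le> 12 * \<sigma>"
      using \<sigma> Rp mult_left_mono[of "1 / R" 4 "3 * \<sigma>"] by (simp add: power2_eq_square)
    then have le1: "cutoff p R x \<le> 1 - 36 * \<sigma>\<^sup>2 - 3 * (y\<^sup>2 / R\<^sup>2)"
      using c e by simp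
    have nn: "\<sigma>\<^sup>2 \<ge> 0" "y\<^sup>2 / R\<^sup>2 \<ge> 0" by simp_all
    have "36 * \<sigma>\<^sup>2 \<le> 1" using le1 x nn by linarith
    then have "(6 * \<sigma>)\<^sup>2 \<le> 1\<^sup>2" by simp
    then have s6: "\<sigma> \<le> 1 / 6" using power2_le_imp_le[of "6 * \<sigma>" 1] by simp
    then have "\<sigma> * R \<le> 1 / 6 * R" using Rp by (intro mult_right_mono) auto
    then have sl: "- (R / 6) \<le> s" using \<sigma> by simp
    have "36 * \<sigma>\<^sup>2 + 3 * (y\<^sup>2 / R\<^sup>2) \<le> 1" using le1 x by linarith
    then have "(36 * \<sigma>\<^sup>2 + 3 * (y\<^sup>2 / R\<^sup>2)) * R\<^sup>2 \<le> 1 * R\<^sup>2" using Rp by (intro mult_right_mono) auto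
    then have yR: "36 * s\<^sup>2 + 3 * y\<^sup>2 \<le> R\<^sup>2" using \<sigma> Rp by (simp add: algebra_simps power_mult_distrib)
    have "s\<^sup>2 > 0" using True by simp
    then have lt: "y\<^sup>2 + s\<^sup>2 < R\<^sup>2" using yR by (smt (verit) zero_le_power2)
    then have "sqrt (y\<^sup>2 + s\<^sup>2) < R" using Rp by (simp add: real_less_lsqrt)
    then have "x \<in> ball p R" by (simp add: xpy dist_prod_def dist_real_def)
    then have "x \<in> upward_sausage R p"
      unfolding upward_sausage_def using Rp by (intro UN_I[of 0]) auto
    moreover have "\<bar>y\<bar> \<le> R"
    proof -
      have "\<bar>y\<bar> \<le> sqrt (y\<^sup>2 + s\<^sup>2)" by (rule real_le_rsqrt) simp
      then show ?thesis using \<open>sqrt (y\<^sup>2 + s\<^sup>2) < R\<close> by linarith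
    qed
    moreover have "s \<le> R\<^sup>2" using True Rp by linarith
    moreover have "cutoff p R x \<le> 3" using le1 nn by linarith
    ultimately show ?thesis using sl by blast
  next
    case False
    then have s0: "s \<ge> 0" by simp
    have nn: "s / R\<^sup>2 \<ge> 0" "y\<^sup>2 / R\<^sup>2 \<ge> 0" "exp (-6 * s / R) > 0" using s0 by simp_all
    have "s / R\<^sup>2 < 1" "y\<^sup>2 / R\<^sup>2 < 1" using c x nn by linarith+
    then have sR: "s < R\<^sup>2" and yR: "y\<^sup>2 < R\<^sup>2" using Rp by (simp_all add: divide_less_eq)
    have y: "\<bar>y\<bar> < R" using yR Rp by (metis abs_of_pos power2_abs power_less_imp_less_base less_eq_real_def)
    have "x \<in> upward_sausage R p"
      unfolding upward_sausage_def
    proof (intro UN_I[of s] image_eqI)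
      show "x = (fst p + y, snd p) + s *\<^sub>R e3" by (simp add: xpy e3_def)
      show "(fst p + y, snd p) \<in> ball p R" using y by (simp add: dist_prod_def dist_real_def)
    qed (use s0 sR in auto)
    moreover have "cutoff p R x \<le> 3" using c nn by linarith
    ultimately show ?thesis using y s0 sR Rp by auto
  qed
  then show "x \<in> upward_sausage R p" "\<bar>fst x - fst p\<bar> \<le> R" "- (R / 6) \<le> snd x - snd p"
    "snd x - snd p \<le> R\<^sup>2" "cutoff p R x \<le> 3"
    by (auto simp: s_def y_def)
qed

lemma compact_cutoff_nonneg:
  assumes R: "R \<ge> 1 / 4"
  shows "compact {x. cutoff p R x \<ge> 0}"
proof -
  have "closed {x. cutoff p R x \<ge> 0}"
    by (intro closed_Collect_le continuous_on_const continuous_on_cutoff)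
  moreover have "{x. cutoff p R x \<ge> 0} \<subseteq> {fst p - R..fst p + R} \<times> {snd p - R / 6..snd p + R\<^sup>2}"
    using cutoff_nonneg(2-4)[OF R, of p] by (force simp: abs_le_iff)
  then have "bounded {x. cutoff p R x \<ge> 0}"
    by (rule bounded_subset[rotated]) (intro bounded_Times bounded_closed_interval)
  ultimately show ?thesis by (simp add: compact_eq_bounded_closed)
qed

text \<open>With \<open>(a, b)\<close> the gradient of the soliton, the last two bounds control the
  squared gradient of the cutoff on the graph, and \<open>L\<close> of the cutoff from below, both
  multiplied by \<open>w\<close>. The constants round up \<open>36 + 1296\<close> and add up
  \<open>216 + 6 + 3\<close>.\<close>

lemma cutoff_jets:
  assumes R: "R \<ge> 1 / 4" and x: "cutoff p R x \<ge> 0"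
  obtains E1 E2 where "\<And>d. djet (cutoff p R) x d (E1 d) (E2 d)"
    "(E1 e2)\<^sup>2 + (E1 e3)\<^sup>2 \<le> 1400 / R\<^sup>2"
    "(E1 e2)\<^sup>2 + (E1 e3)\<^sup>2 + (E1 (b, -a))\<^sup>2 \<le> 1400 * (1 + a\<^sup>2 + b\<^sup>2) / R\<^sup>2"
    "- 225 * (1 + a\<^sup>2 + b\<^sup>2) / R\<^sup>2
       \<le> E2 e2 + E2 e3 + E2 (b, -a) + (1 + a\<^sup>2 + b\<^sup>2) * E1 e3"
proof -
  define s where "s = snd x - snd p"
  define y where "y = fst x - fst p"
  define e where "e = exp (-6 * s / R)"
  have Rp: "R > 0" "R\<^sup>2 > 0" using R by auto
  define c where "c = 1 / R\<^sup>2"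
  have cp: "c > 0" using Rp by (simp add: c_def)
  define E1 where "E1 d = 12 * e * snd d / R - 3 * c * snd d - 6 * c * y * fst d" for d :: plane
  define E2 where "E2 d = - 72 * c * e * (snd d)\<^sup>2 - 6 * c * (fst d)\<^sup>2" for d :: plane
  have js: "djet (\<lambda>x. (-6 / R) * (snd x + - snd p)) x d ((-6 / R) * (snd d + 0)) ((-6 / R) * (0 + 0))" for d
    by (intro djet_cmult djet_add djet_snd djet_const)
  have jet: "djet (cutoff p R) x d (E1 d) (E2 d)" for d
    by (rule djet_cong[OF djet_add[OF djet_add[OF djet_const[of 3] djet_cmult[of _ _ _ _ _ "-2", OF djet_exp[OF js]]]
        djet_add[OF djet_cmult[of _ _ _ _ _ "- 3 * c", OF djet_add[OF djet_snd djet_const[of "- snd p"]]]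
          djet_cmult[of _ _ _ _ _ "- 3 * c", OF djet_power2[OF djet_add[OF djet_fst djet_const[of "- fst p"]]]]]]])
      (use Rp in \<open>simp_all add: cutoff_def c_def E1_def E2_def e_def s_def y_def field_simps power2_eq_square\<close>)
  \<comment> \<open>The region extends at most \<open>R / 6\<close> below \<open>p\<close>, so the
    exponent is at most 1.\<close>
  have "-6 * s / R \<le> 1" using cutoff_nonneg(3)[OF R x] Rp by (simp add: s_def divide_le_eq)
  then have e3: "e \<le> 3" unfolding e_def using exp_le order_trans exp_le_cancel_iff by blast
  have e0: "e > 0" by (simp add: e_def)
  have yR: "\<bar>y\<bar> \<le> R" using cutoff_nonneg(2)[OF R x] by (simp add: y_def)
  have v: "E1 e2 = - 6 * c * y" "E1 e3 = 12 * e / R - 3 * c"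
    by (simp_all add: E1_def e2_def e3_def)
  have "1 / R \<le> 4" using R by (simp add: divide_le_eq)
  then have "c \<le> 4 * (1 / R)" using Rp mult_right_mono[of "1 / R" 4 "1 / R"]
    by (simp add: c_def power2_eq_square)
  then have c4: "3 * c \<le> 12 / R" by simp
  have "y\<^sup>2 \<le> R\<^sup>2" using yR Rp by (simp add: abs_le_square_iff[symmetric])
  then have "c * y\<^sup>2 \<le> 1" using Rp by (simp add: c_def)
  then have "36 * c * (c * y\<^sup>2) \<le> 36 * c * 1" using cp by (intro mult_left_mono) auto
  then have y2: "(E1 e2)\<^sup>2 \<le> 36 * c" by (simp add: v power2_eq_square mult_ac)
  have "12 * e / R \<le> 36 / R" "0 \<le> 12 * e / R" using e3 e0 Rp by (simp_all add: divide_right_mono)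
  then have "\<bar>E1 e3\<bar> \<le> 36 / R" unfolding v abs_le_iff using c4 cp by (intro conjI; linarith)
  then have "(E1 e3)\<^sup>2 \<le> (36 / R)\<^sup>2" using Rp by (simp add: abs_le_square_iff[symmetric])
  then have s2: "(E1 e3)\<^sup>2 \<le> 1296 * c" by (simp add: c_def power_divide)
  have g: "(E1 e2)\<^sup>2 + (E1 e3)\<^sup>2 \<le> 1400 * c" using y2 s2 cp by linarith
  have n: "E1 (b, -a) = b * E1 e2 - a * E1 e3"
    by (simp add: E1_def e2_def e3_def algebra_simps)
  \<comment> \<open>Lagrange's identity, giving the Cauchy-Schwarz bound for the derivative along
    \<open>(b, -a)\<close>.\<close>
  have "(a\<^sup>2 + b\<^sup>2) * ((E1 e2)\<^sup>2 + (E1 e3)\<^sup>2) - (E1 (b, -a))\<^sup>2 = (a * E1 e2 + b * E1 e3)\<^sup>2"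
    unfolding n by algebra
  then have "(E1 (b, -a))\<^sup>2 \<le> (a\<^sup>2 + b\<^sup>2) * ((E1 e2)\<^sup>2 + (E1 e3)\<^sup>2)"
    by (smt (verit) zero_le_power2)
  then have "(E1 e2)\<^sup>2 + (E1 e3)\<^sup>2 + (E1 (b, -a))\<^sup>2 \<le> (1 + a\<^sup>2 + b\<^sup>2) * ((E1 e2)\<^sup>2 + (E1 e3)\<^sup>2)"
    by (simp add: algebra_simps)
  also have "\<dots> \<le> (1 + a\<^sup>2 + b\<^sup>2) * (1400 * c)" using g by (intro mult_left_mono) auto
  finally have g3: "(E1 e2)\<^sup>2 + (E1 e3)\<^sup>2 + (E1 (b, -a))\<^sup>2 \<le> 1400 * (1 + a\<^sup>2 + b\<^sup>2) * c"
    by (simp add: mult_ac)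
  have ec: "c * e \<le> 3 * c" using e3 cp by simp
  have "72 * (c * e) * (1 + a\<^sup>2) \<le> 216 * c * (1 + a\<^sup>2)" using ec by (intro mult_right_mono) auto
  moreover have "(1 + a\<^sup>2 + b\<^sup>2) * (-3 * c) \<le> (1 + a\<^sup>2 + b\<^sup>2) * E1 e3"
    unfolding v using e0 Rp by (intro mult_left_mono) auto
  moreover have "E2 e2 + E2 e3 + E2 (b, -a) = - 72 * (c * e) * (1 + a\<^sup>2) - 6 * c * (1 + b\<^sup>2)"
    by (simp add: E2_def e2_def e3_def algebra_simps)
  moreover have "0 \<le> c * a\<^sup>2" "0 \<le> c * b\<^sup>2" using cp by simp_all
  ultimately have L: "- 225 * (1 + a\<^sup>2 + b\<^sup>2) * c
       \<le> E2 e2 + E2 e3 + E2 (b, -a) + (1 + a\<^sup>2 + b\<^sup>2) * E1 e3"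
    by (simp add: algebra_simps)
  show thesis
    by (rule that[OF jet]) (use g g3 L in \<open>simp_all add: c_def\<close>)
qed

section \<open>Preparations for the maximum principle\<close>

lemma continuous_on_norm_grad:
  assumes u: "translating_soliton_on \<Omega> u"
  shows "continuous_on \<Omega> (\<lambda>x. (norm (grad u x))\<^sup>2)" "continuous_on \<Omega> u"
proof -
  have sm: "smooth_on \<Omega> u" using u by (simp add: translating_soliton_on_def)
  have "continuous_on \<Omega> (partial e2 u)" "continuous_on \<Omega> (partial e3 u)"
    using smooth_on_imp(1)[OF sm, of 1] by auto
  then show "continuous_on \<Omega> (\<lambda>x. (norm (grad u x))\<^sup>2)"
    by (auto simp: grad_def norm_Pair intro!: continuous_intros)
  show "continuous_on \<Omega> u" using smooth_on_imp(1)[OF sm, of 0] by simp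
qed

text \<open>Turns a maximum over a set of the form "constraint functions nonnegative" into a local
  maximum, once the constraints are strictly positive there.\<close>

lemma eventually_positive:
  fixes f :: "plane \<Rightarrow> real"
  assumes "open S" "x \<in> S" "continuous_on S f" "f x > 0"
  shows "\<forall>\<^sub>F y in nhds x. f y > 0"
proof -
  have "isCont f x" using assms by (simp add: continuous_on_eq_continuous_at)
  then have "filterlim f (nhds (f x)) (nhds x)"
    by (simp add: isCont_def tendsto_at_iff_tendsto_nhds)
  then show ?thesis using assms(4) by (rule order_tendstoD)
qed

text \<open>The pointwise algebra of Korevaar's method at a maximum of
  \<open>\<zeta>\<^sup>2 * w\<close>. The indices 1, 2, 3 stand for \<open>e2\<close>,
  \<open>e3\<close>, \<open>(b, -a)\<close>; \<open>Z\<close>, \<open>Y\<close> are derivatives of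
  \<open>\<zeta>\<close> and \<open>H\<close>, \<open>V\<close> those of \<open>h\<close>. The
  first-order conditions turn all gradient terms into \<open>- 6 * w * Z\<close>, which
  \<open>key\<close> compensates.\<close>

lemma weight_times_gradient_max:
  fixes \<zeta> w h :: real
  assumes \<zeta>: "\<zeta> > 0" and h: "h > 0" and w: "w = 1 + h"
    and first: "2 * \<zeta> * Z1 * w + \<zeta>\<^sup>2 * H1 = 0" "2 * \<zeta> * Z2 * w + \<zeta>\<^sup>2 * H2 = 0"
      "2 * \<zeta> * Z3 * w + \<zeta>\<^sup>2 * H3 = 0"
    and second: "(2 * Z1\<^sup>2 + 2 * \<zeta> * Y1) * w + 4 * \<zeta> * Z1 * H1 + \<zeta>\<^sup>2 * V1 \<le> 0"
      "(2 * Z2\<^sup>2 + 2 * \<zeta> * Y2) * w + 4 * \<zeta> * Z2 * H2 + \<zeta>\<^sup>2 * V2 \<le> 0"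
      "(2 * Z3\<^sup>2 + 2 * \<zeta> * Y3) * w + 4 * \<zeta> * Z3 * H3 + \<zeta>\<^sup>2 * V3 \<le> 0"
    and key: "(3 * h + 1) * (H1\<^sup>2 + H2\<^sup>2 + H3\<^sup>2) \<le> 2 * w * h * (V1 + V2 + V3 + w * H2)"
  shows "Y1 + Y2 + Y3 + w * Z2 \<le> 0"
proof -
  define Q where "Q = V1 + V2 + V3 + w * H2"
  define Z where "Z = Z1\<^sup>2 + Z2\<^sup>2 + Z3\<^sup>2"
  have wp: "w > 0" using w h by simp
  have H': "\<zeta> * H' = - 2 * w * Z'" if "2 * \<zeta> * Z' * w + \<zeta>\<^sup>2 * H' = 0" for Z' H'
  proof -
    have "\<zeta> * (\<zeta> * H') = \<zeta> * (- 2 * w * Z')" using that by (simp add: power2_eq_square algebra_simps)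
    moreover have "\<zeta> \<noteq> 0" using \<zeta> by simp
    ultimately show ?thesis using mult_left_cancel by blast
  qed
  note H = H'[OF first(1)] H'[OF first(2)] H'[OF first(3)]
  have "4 * w\<^sup>2 * Z = (\<zeta> * H1)\<^sup>2 + (\<zeta> * H2)\<^sup>2 + (\<zeta> * H3)\<^sup>2"
    unfolding H Z_def by algebra
  \<comment> \<open>Inserting the first-order conditions into \<open>key\<close> and discarding the
    nonnegative \<open>2 * w * Z\<close> leaves exactly the required coefficient 6.\<close>
  then have "(3 * h + 1) * (4 * w\<^sup>2 * Z) = \<zeta>\<^sup>2 * ((3 * h + 1) * (H1\<^sup>2 + H2\<^sup>2 + H3\<^sup>2))"
    by (simp add: algebra_simps power_mult_distrib)
  also have "\<dots> \<le> \<zeta>\<^sup>2 * (2 * w * h * Q)" using key unfolding Q_def by (intro mult_left_mono) auto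
  finally have "2 * w * (2 * w * (3 * h + 1) * Z) \<le> 2 * w * (h * (\<zeta>\<^sup>2 * Q))"
    by (simp add: algebra_simps power2_eq_square)
  then have "2 * w * (3 * h + 1) * Z \<le> h * (\<zeta>\<^sup>2 * Q)" by (rule mult_left_le_imp_le) (use wp in simp)
  moreover have "0 \<le> 2 * w * Z" using wp by (simp add: Z_def)
  ultimately have "h * (6 * w * Z) \<le> h * (\<zeta>\<^sup>2 * Q)" by (simp add: algebra_simps)
  then have QZ: "6 * w * Z \<le> \<zeta>\<^sup>2 * Q" using h by simp
  have "(2 * Z1\<^sup>2 + 2 * \<zeta> * Y1) * w + 4 * Z1 * (\<zeta> * H1) + \<zeta>\<^sup>2 * V1 \<le> 0"
    "(2 * Z2\<^sup>2 + 2 * \<zeta> * Y2) * w + 4 * Z2 * (\<zeta> * H2) + \<zeta>\<^sup>2 * V2 \<le> 0"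
    "(2 * Z3\<^sup>2 + 2 * \<zeta> * Y3) * w + 4 * Z3 * (\<zeta> * H3) + \<zeta>\<^sup>2 * V3 \<le> 0"
    using second by (simp_all add: mult_ac)
  moreover have "w * (2 * \<zeta> * Z2 * w + \<zeta>\<^sup>2 * H2) = 0" using first(2) by simp
  moreover have "2 * \<zeta> * w * (Y1 + Y2 + Y3 + w * Z2)
     = ((2 * Z1\<^sup>2 + 2 * \<zeta> * Y1) * w + 4 * Z1 * (\<zeta> * H1) + \<zeta>\<^sup>2 * V1)
     + ((2 * Z2\<^sup>2 + 2 * \<zeta> * Y2) * w + 4 * Z2 * (\<zeta> * H2) + \<zeta>\<^sup>2 * V2)
     + ((2 * Z3\<^sup>2 + 2 * \<zeta> * Y3) * w + 4 * Z3 * (\<zeta> * H3) + \<zeta>\<^sup>2 * V3)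
     + w * (2 * \<zeta> * Z2 * w + \<zeta>\<^sup>2 * H2) + 6 * w * Z - \<zeta>\<^sup>2 * Q"
    unfolding H Z_def Q_def by algebra
  ultimately have "2 * \<zeta> * w * (Y1 + Y2 + Y3 + w * Z2) \<le> 0" using QZ by linarith
  then show ?thesis using \<zeta> wp by (simp add: mult_le_0_iff)
qed

text \<open>The pointwise algebra of Bernstein's method at a maximum of
  \<open>\<eta>\<^sup>2 * h + l * u\<^sup>2\<close>. The equation removes the term with
  \<open>u\<close> times its second derivatives, so the square of \<open>u\<close> contributes
  \<open>2 * l * h\<close>; the cross terms are absorbed by completing squares, and a factor
  \<open>h\<close> is divided out.\<close>

lemma cutoff_gradient_plus_square_max:
  fixes \<eta> w h l :: real
  assumes h: "h > 0" and w: "w = 1 + h"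
    and first: "2 * \<eta> * E2 * h + \<eta>\<^sup>2 * H2 + l * (2 * u * u2) = 0"
    and second: "(2 * E1\<^sup>2 + 2 * \<eta> * F1) * h + 4 * \<eta> * E1 * H1 + \<eta>\<^sup>2 * V1 + l * (2 * u1\<^sup>2 + 2 * u * U1) \<le> 0"
      "(2 * E2\<^sup>2 + 2 * \<eta> * F2) * h + 4 * \<eta> * E2 * H2 + \<eta>\<^sup>2 * V2 + l * (2 * u2\<^sup>2 + 2 * u * U2) \<le> 0"
      "(2 * E3\<^sup>2 + 2 * \<eta> * F3) * h + 4 * \<eta> * E3 * H3 + \<eta>\<^sup>2 * V3 + l * (2 * u3\<^sup>2 + 2 * u * U3) \<le> 0"
    and key: "(3 * h + 1) * (H1\<^sup>2 + H2\<^sup>2 + H3\<^sup>2) \<le> 2 * w * h * (V1 + V2 + V3 + w * H2)"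
    and u: "u1\<^sup>2 + u2\<^sup>2 + u3\<^sup>2 = h" "U1 + U2 + U3 + w * u2 = 0"
  shows "2 * l \<le> 6 * (E1\<^sup>2 + E2\<^sup>2 + E3\<^sup>2) - 2 * \<eta> * (F1 + F2 + F3 + w * E2)"
proof -
  define Q where "Q = V1 + V2 + V3 + w * H2"
  define Z where "Z = H1\<^sup>2 + H2\<^sup>2 + H3\<^sup>2"
  have wp: "w > 0" using w h by simp
  have "w * Z \<le> (3 * h + 1) * Z" using w h by (intro mult_right_mono) (auto simp: Z_def)
  also have "\<dots> \<le> w * (2 * h * Q)" using key by (simp add: Z_def Q_def mult_ac)
  finally have ZQ: "Z \<le> 2 * h * Q" using wp by simp
  \<comment> \<open>The weight \<open>4 * h\<close> makes the mixed terms
    \<open>8 * h * \<eta>\<close> times the cross terms. The price is 8 times the squared gradient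
    of the cutoff, of which 2 are already present, hence the 6.\<close>
  have sq: "0 \<le> (\<eta> * H1 + 4 * h * E1)\<^sup>2 + (\<eta> * H2 + 4 * h * E2)\<^sup>2 + (\<eta> * H3 + 4 * h * E3)\<^sup>2" by simp
  have "\<eta>\<^sup>2 * Z \<le> \<eta>\<^sup>2 * (2 * h * Q)" using ZQ by (intro mult_left_mono) auto
  with sq have "0 \<le> 2 * h * (\<eta>\<^sup>2 * Q + 4 * \<eta> * (E1 * H1 + E2 * H2 + E3 * H3) + 8 * h * (E1\<^sup>2 + E2\<^sup>2 + E3\<^sup>2))"
    by (simp add: algebra_simps power2_eq_square Z_def)
  then have c: "0 \<le> \<eta>\<^sup>2 * Q + 4 * \<eta> * (E1 * H1 + E2 * H2 + E3 * H3) + 8 * h * (E1\<^sup>2 + E2\<^sup>2 + E3\<^sup>2)"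
    using h by (simp add: zero_le_mult_iff)
  have U: "U1 = - (U2 + U3 + w * u2)" using u(2) by linarith
  have "h * (2 * l - (6 * (E1\<^sup>2 + E2\<^sup>2 + E3\<^sup>2) - 2 * \<eta> * (F1 + F2 + F3 + w * E2)))
    = ((2 * E1\<^sup>2 + 2 * \<eta> * F1) * h + 4 * \<eta> * E1 * H1 + \<eta>\<^sup>2 * V1 + l * (2 * u1\<^sup>2 + 2 * u * U1))
    + ((2 * E2\<^sup>2 + 2 * \<eta> * F2) * h + 4 * \<eta> * E2 * H2 + \<eta>\<^sup>2 * V2 + l * (2 * u2\<^sup>2 + 2 * u * U2))
    + ((2 * E3\<^sup>2 + 2 * \<eta> * F3) * h + 4 * \<eta> * E3 * H3 + \<eta>\<^sup>2 * V3 + l * (2 * u3\<^sup>2 + 2 * u * U3))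
    + w * (2 * \<eta> * E2 * h + \<eta>\<^sup>2 * H2 + l * (2 * u * u2))
    - (\<eta>\<^sup>2 * Q + 4 * \<eta> * (E1 * H1 + E2 * H2 + E3 * H3) + 8 * h * (E1\<^sup>2 + E2\<^sup>2 + E3\<^sup>2))"
    unfolding U Q_def u(1)[symmetric] by algebra
  also have "\<dots> \<le> 0" using second first c by simp
  finally show ?thesis using h by (simp add: mult_le_0_iff)
qed

lemma upward_sausage_center: "R > 0 \<Longrightarrow> p \<in> upward_sausage R p"
  unfolding upward_sausage_def by (intro UN_I[of 0]) auto

text \<open>Korevaar's method: at an interior maximum of \<open>\<zeta>\<^sup>2 w\<close> one has \<open>L \<zeta> \<le> 0\<close>, whereas \<open>L \<zeta> > 0\<close> for
  \<open>\<zeta> = e\<^bsup>K\<phi>\<^esup> - 1\<close> wherever \<open>w\<close> is large, because there \<open>|\<nabla>\<phi>|\<close> is bounded below on the graph.\<close>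

lemma gradient_bound:
  assumes S: "open \<Omega>" and u: "translating_soliton_on \<Omega> u"
    and R: "R \<ge> 1 / 4" and p: "upward_sausage R p \<subseteq> \<Omega>"
    and N: "N \<ge> 1" "\<And>x. x \<in> \<Omega> \<Longrightarrow> \<bar>u x\<bar> \<le> N"
  shows "1 + (norm (grad u p))\<^sup>2 \<le> exp (3000000 * N\<^sup>2) * (6000000 * N\<^sup>2)"
proof -
  define h where "h x = (norm (grad u x))\<^sup>2" for x
  \<comment> \<open>With this slope \<open>c * u\<close> stays within \<open>1 / 4\<close>, so on
    \<Omega> the function \<open>\<phi>\<close> lies below the cutoff, while \<open>\<phi> p\<close>
    is at least \<open>1 / 2\<close>.\<close>
  define c where "c = 1 / (4 * N)"
  define K where "K = 500000 * N\<^sup>2"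
  define \<phi> where "\<phi> x = cutoff p R x + (c * u x + - (1 / 4))" for x
  define \<zeta> where "\<zeta> x = exp (K * \<phi> x) + - 1" for x
  define G where "G x = (\<zeta> x)\<^sup>2 * (1 + h x)" for x
  \<comment> \<open>Outside \<Omega> the function \<open>u\<close> is arbitrary, so positivity of
    \<open>\<phi>\<close> alone would not confine the set; it is closed only relative to the compact
    region of the cutoff.\<close>
  define D where "D = {x. cutoff p R x \<ge> 0} \<inter> {x \<in> {x. cutoff p R x \<ge> 0}. \<phi> x \<ge> 0}"
  have cp: "c > 0" and cN: "c * N = 1 / 4" using N by (simp_all add: c_def)
  have N2: "N\<^sup>2 \<ge> 1" using N by simp
  have Kp: "K \<ge> 2" using N2 by (simp add: K_def)
  have sub: "{x. cutoff p R x \<ge> 0} \<subseteq> \<Omega>" using cutoff_nonneg(1)[OF R] p by blast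
  have pO: "p \<in> \<Omega>" using sub cutoff_center[of p R] by auto
  have cu: "\<bar>c * u x\<bar> \<le> 1 / 4" if "x \<in> \<Omega>" for x
    using mult_left_mono[OF N(2)[OF that], of c] cp cN by (simp add: abs_mult)
  note cont = continuous_on_norm_grad[OF u]
  have c\<phi>: "continuous_on \<Omega> \<phi>" unfolding \<phi>_def
    by (intro continuous_intros continuous_on_cutoff cont)
  have cG: "continuous_on \<Omega> G" unfolding G_def \<zeta>_def h_def
    by (intro continuous_intros c\<phi> cont)
  have D: "compact D" unfolding D_def
  proof (rule compact_Int_closed)
    show "compact {x. cutoff p R x \<ge> 0}" by (rule compact_cutoff_nonneg[OF R])
    show "closed {x \<in> {x. cutoff p R x \<ge> 0}. \<phi> x \<ge> 0}"
      using compact_imp_closed[OF compact_cutoff_nonneg[OF R, of p]]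
      by (intro continuous_on_closed_Collect_le continuous_on_const continuous_on_subset[OF c\<phi> sub]) auto
  qed
  have DO: "D \<subseteq> \<Omega>" using sub by (auto simp: D_def)
  have \<phi>p: "\<phi> p \<ge> 1 / 2" using cu[OF pO] by (simp add: \<phi>_def cutoff_center abs_le_iff)
  then have pD: "p \<in> D" by (simp add: D_def cutoff_center)
  obtain x where x: "x \<in> D" "\<And>y. y \<in> D \<Longrightarrow> G y \<le> G x"
    using continuous_attains_sup[OF D _ continuous_on_subset[OF cG DO]] pD by blast
  have xO: "x \<in> \<Omega>" and x0: "cutoff p R x \<ge> 0" "\<phi> x \<ge> 0" using x DO by (auto simp: D_def)
  have hnn: "h y \<ge> 0" for y by (simp add: h_def)
  have "1 \<le> K * \<phi> p" using Kp \<phi>p mult_mono[of 2 K "1/2" "\<phi> p"] by simp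
  then have \<zeta>p: "\<zeta> p \<ge> 1" using exp_ge_add_one_self[of "K * \<phi> p"] unfolding \<zeta>_def by linarith
  then have "1 * (1 + h p) \<le> G p" unfolding G_def
    using hnn[of p] by (intro mult_right_mono) auto
  then have Gp: "1 + h p \<le> G x" using x(2)[OF pD] by simp
  have \<phi>pos: "\<phi> x > 0"
  proof (rule ccontr)
    assume "\<not> \<phi> x > 0"
    then have "\<phi> x = 0" using x0 by simp
    then have "G x = 0" by (simp add: G_def \<zeta>_def)
    then show False using Gp hnn[of p] by simp
  qed
  then have \<eta>pos: "cutoff p R x > 0" using cu[OF xO] by (simp add: \<phi>_def abs_le_iff)
  have small: "1 + h x < 6000000 * N\<^sup>2"
  proof (rule ccontr)
    assume "\<not> ?thesis"
    then have big: "1 + h x \<ge> 6000000 * N\<^sup>2" by simp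
    define w where "w = 1 + h x"
    have wbig: "w \<ge> 6000000 * N\<^sup>2" using big by (simp add: w_def)
    then have w2: "w \<ge> 2" and hp: "h x > 0" using N2 by (auto simp: w_def)
    have ev: "\<forall>\<^sub>F y in nhds x. G y \<le> G x"
      using eventually_positive[OF S xO c\<phi> \<phi>pos]
        eventually_positive[OF open_UNIV UNIV_I continuous_on_cutoff \<eta>pos]
      by eventually_elim (intro x(2), auto simp: D_def)
    define a b where "a = partial e2 u x" and "b = partial e3 u x"
    have hab: "h x = a\<^sup>2 + b\<^sup>2" by (simp add: h_def grad_def norm_Pair a_def b_def)
    then have wab: "w = 1 + a\<^sup>2 + b\<^sup>2" by (simp add: w_def)
    obtain U H V where jets:
      "\<And>d. djet u x d (fst d * a + snd d * b) (U d)"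
      "U e2 + U e3 + U (b, -a) + w * b = 0"
      "\<And>d. djet h x d (H d) (V d)"
      "(3 * h x + 1) * ((H e2)\<^sup>2 + (H e3)\<^sup>2 + (H (b, -a))\<^sup>2)
         \<le> 2 * w * h x * (V e2 + V e3 + V (b, -a) + w * H e3)"
      using soliton_jets[OF S xO u] unfolding h_def a_def b_def w_def by metis
    obtain E1 E2 where E: "\<And>d. djet (cutoff p R) x d (E1 d) (E2 d)"
      "(E1 e2)\<^sup>2 + (E1 e3)\<^sup>2 \<le> 1400 / R\<^sup>2"
      "- 225 * w / R\<^sup>2 \<le> E2 e2 + E2 e3 + E2 (b, -a) + w * E1 e3"
      using cutoff_jets[OF R x0(1), where a=a and b=b, folded wab] by blast
    define P1 where "P1 d = E1 d + c * (fst d * a + snd d * b)" for d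
    define P2 where "P2 d = E2 d + c * U d" for d
    define e where "e = exp (K * \<phi> x)"
    define Z1 where "Z1 d = e * K * P1 d" for d
    define Z2 where "Z2 d = e * K * (P2 d + K * (P1 d)\<^sup>2)" for d
    have j\<phi>: "djet \<phi> x d (P1 d) (P2 d)" for d
      by (rule djet_cong[OF djet_add[OF E(1) djet_add[OF djet_cmult[OF jets(1), of c] djet_const[of "- (1/4)"]]]])
        (auto simp: \<phi>_def P1_def P2_def)
    have j\<zeta>: "djet \<zeta> x d (Z1 d) (Z2 d)" for d
      by (rule djet_cong[OF djet_add[OF djet_exp[OF djet_cmult[OF j\<phi>, of K]] djet_const[of "-1"]]])
        (auto simp: \<zeta>_def Z1_def Z2_def e_def power2_eq_square algebra_simps)
    have jG: "djet G x d (2 * \<zeta> x * Z1 d * w + (\<zeta> x)\<^sup>2 * H d)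
       ((2 * (Z1 d)\<^sup>2 + 2 * \<zeta> x * Z2 d) * w + 4 * \<zeta> x * Z1 d * H d + (\<zeta> x)\<^sup>2 * V d)" for d
      by (rule djet_cong[OF djet_mult[OF djet_power2[OF j\<zeta>] djet_add[OF djet_const[of 1] jets(3)]]])
        (auto simp: G_def w_def)
    have ep: "e > 0" by (simp add: e_def)
    have "\<zeta> x > 0" using \<phi>pos Kp by (simp add: \<zeta>_def)
    then have "Z2 e2 + Z2 e3 + Z2 (b, -a) + w * Z1 e3 \<le> 0"
      by (rule weight_times_gradient_max[OF _ hp w_def djet_local_max(1)[OF jG ev] djet_local_max(1)[OF jG ev]
        djet_local_max(1)[OF jG ev] djet_local_max(2)[OF jG ev] djet_local_max(2)[OF jG ev]
        djet_local_max(2)[OF jG ev] jets(4)])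
    \<comment> \<open>The exponential produces the gain \<open>K\<close> times the squared gradient
      of \<open>\<phi>\<close>.\<close>
    also have "Z2 e2 + Z2 e3 + Z2 (b, -a) + w * Z1 e3 = e * K * (P2 e2 + P2 e3 + P2 (b, -a) + w * P1 e3
        + K * ((P1 e2)\<^sup>2 + (P1 e3)\<^sup>2 + (P1 (b, -a))\<^sup>2))"
      by (simp add: Z1_def Z2_def algebra_simps)
    finally have "P2 e2 + P2 e3 + P2 (b, -a) + w * P1 e3
        + K * ((P1 e2)\<^sup>2 + (P1 e3)\<^sup>2 + (P1 (b, -a))\<^sup>2) \<le> 0"
      using ep Kp by (simp add: mult_le_0_iff)
    \<comment> \<open>\<open>L u = 0\<close> removes the contribution of \<open>u\<close>, leaving
      only the cutoff.\<close>
    moreover have "P2 e2 + P2 e3 + P2 (b, -a) + w * P1 e3 = (E2 e2 + E2 e3 + E2 (b, -a) + w * E1 e3)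
        + c * (U e2 + U e3 + U (b, -a) + w * b)"
      by (simp add: P1_def P2_def e3_def algebra_simps)
    ultimately have main: "K * ((P1 e2)\<^sup>2 + (P1 e3)\<^sup>2 + (P1 (b, -a))\<^sup>2) \<le> 225 * w / R\<^sup>2"
      using E(3) jets(2) by simp
    have "(1 / 4)\<^sup>2 \<le> R\<^sup>2" using R by (intro power_mono) auto
    then have R2: "1 / R\<^sup>2 \<le> 16" using R by (simp add: divide_le_eq power2_eq_square)
    \<comment> \<open>Young's inequality: the slope of \<open>c * u\<close> survives up to a factor
      2 against the bounded slope of the cutoff.\<close>
    have half: "(c * z)\<^sup>2 / 2 - y\<^sup>2 \<le> (y + c * z)\<^sup>2" for y z
    proof -
      have "(y + c * z)\<^sup>2 - ((c * z)\<^sup>2 / 2 - y\<^sup>2) = (2 * y + c * z)\<^sup>2 / 2" by (simp add: power2_eq_square algebra_simps)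
      then show ?thesis by (smt (verit) divide_nonneg_pos zero_le_power2)
    qed
    have "c\<^sup>2 * h x / 2 - 1400 / R\<^sup>2 \<le> (P1 e2)\<^sup>2 + (P1 e3)\<^sup>2"
      using half[of a "E1 e2"] half[of b "E1 e3"] E(2)
      by (simp add: P1_def e2_def e3_def hab algebra_simps power_mult_distrib)
    moreover have "1400 / R\<^sup>2 \<le> 22400" using R2 by simp
    moreover have c2: "c\<^sup>2 = 1 / (16 * N\<^sup>2)" by (simp add: c_def power2_eq_square)
    have "w / (64 * N\<^sup>2) \<le> c\<^sup>2 * h x / 2"
    proof -
      have "c\<^sup>2 * (w / 2) \<le> c\<^sup>2 * h x" using w2 by (intro mult_left_mono) (auto simp: w_def)
      then show ?thesis by (simp add: c2)
    qed
    \<comment> \<open>The threshold on \<open>w\<close> makes half of the main term exceed the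
      cutoff error 22400; \<open>K\<close> is chosen so that the remaining half yields
      \<open>3906.25 * w\<close>, more than the upper bound \<open>3600 * w\<close>.\<close>
    moreover have "46875 \<le> w / (128 * N\<^sup>2)" using wbig N by (simp add: le_divide_eq)
    moreover have "w / (64 * N\<^sup>2) = 2 * (w / (128 * N\<^sup>2))" by simp
    moreover have "(P1 (b, -a))\<^sup>2 \<ge> 0" by simp
    ultimately have "w / (128 * N\<^sup>2) \<le> (P1 e2)\<^sup>2 + (P1 e3)\<^sup>2 + (P1 (b, -a))\<^sup>2" by linarith
    then have "K * (w / (128 * N\<^sup>2)) \<le> 225 * w / R\<^sup>2"
      using main Kp mult_left_mono[of "w / (128 * N\<^sup>2)" _ K] by fastforce
    also have "\<dots> \<le> 3600 * w" using mult_left_mono[OF R2, of "225 * w"] w2 by simp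
    also have "K * (w / (128 * N\<^sup>2)) = 3906.25 * w" using N by (simp add: K_def)
    finally show False using w2 by simp
  qed
  \<comment> \<open>With \<open>w\<close> small at the maximum point, it remains to bound the weight
    there.\<close>
  have "cutoff p R x \<le> 3" by (rule cutoff_nonneg(5)[OF R x0(1)])
  then have "\<phi> x \<le> 3" using cu[OF xO] by (simp add: \<phi>_def abs_le_iff)
  then have "exp (K * \<phi> x) \<le> exp (3 * K)" using Kp by simp
  moreover have "\<zeta> x \<ge> 0" using x0 Kp by (simp add: \<zeta>_def)
  moreover have "\<zeta> x \<le> exp (K * \<phi> x)" by (simp add: \<zeta>_def)
  ultimately have "(\<zeta> x)\<^sup>2 \<le> (exp (3 * K))\<^sup>2" by (intro power_mono) linarith+
  also have "\<dots> = exp (3000000 * N\<^sup>2)" by (simp add: exp_double[symmetric] K_def)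
  finally have "G x \<le> exp (3000000 * N\<^sup>2) * (6000000 * N\<^sup>2)"
    unfolding G_def using small hnn[of x] by (intro mult_mono) auto
  then show ?thesis using Gp by (simp add: h_def)
qed

text \<open>Bernstein's method: the auxiliary function is \<open>\<eta>\<^sup>2 |\<nabla>u|\<^sup>2 + \<mu> u\<^sup>2\<close> with \<open>\<mu>\<close> of order \<open>1 / R\<^sup>2\<close>.\<close>

lemma gradient_decay:
  assumes S: "open \<Omega>" and u: "translating_soliton_on \<Omega> u"
    and R: "R \<ge> 1 / 4" and p: "upward_sausage R p \<subseteq> \<Omega>"
    and N: "\<And>x. x \<in> \<Omega> \<Longrightarrow> \<bar>u x\<bar> \<le> N"
    and B: "\<And>x. x \<in> upward_sausage R p \<Longrightarrow> 1 + (norm (grad u x))\<^sup>2 \<le> B"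
  shows "(norm (grad u p))\<^sup>2 \<le> 7000 * B / R\<^sup>2 * N\<^sup>2"
proof -
  define h where "h x = (norm (grad u x))\<^sup>2" for x
  define \<mu> where "\<mu> = 7000 * B / R\<^sup>2"
  define F where "F x = (cutoff p R x)\<^sup>2 * h x + \<mu> * (u x)\<^sup>2" for x
  define D where "D = {x. cutoff p R x \<ge> 0}"
  have hnn: "h y \<ge> 0" for y by (simp add: h_def)
  have sub: "D \<subseteq> \<Omega>" using cutoff_nonneg(1)[OF R] p unfolding D_def by blast
  have pD: "p \<in> D" by (simp add: D_def cutoff_center)
  have Rp: "R\<^sup>2 > 0" using R by simp
  have "1 + h p \<le> B" using B[OF cutoff_nonneg(1)[OF R]] pD by (simp add: h_def D_def)
  then have B1: "B \<ge> 1" using hnn[of p] by simp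
  then have lp: "\<mu> > 0" using Rp by (simp add: \<mu>_def)
  have "continuous_on \<Omega> F" unfolding F_def h_def
    by (intro continuous_intros continuous_on_cutoff continuous_on_norm_grad[OF u])
  then obtain x where x: "x \<in> D" "\<And>y. y \<in> D \<Longrightarrow> F y \<le> F x"
    using continuous_attains_sup[of D F] compact_cutoff_nonneg[OF R] pD continuous_on_subset[OF _ sub]
    unfolding D_def by blast
  have xO: "x \<in> \<Omega>" and x0: "cutoff p R x \<ge> 0" using x sub by (auto simp: D_def)
  \<comment> \<open>A maximum with both factors positive would violate the differential inequality,
    since \<open>2 * \<mu>\<close> is 14000 times \<open>B / R\<^sup>2\<close> while the cutoff
    terms give at most \<open>6 * 1400 + 6 * 225 = 9750\<close> times it. Hence only the term
    \<open>\<mu> * (u x)\<^sup>2\<close> survives at the maximum.\<close>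
  have vanish: "cutoff p R x = 0 \<or> h x = 0"
  proof (rule ccontr)
    assume "\<not> ?thesis"
    then have \<eta>pos: "cutoff p R x > 0" and hp: "h x > 0" using x0 hnn[of x] by auto
    define \<eta> where "\<eta> = cutoff p R x"
    define w where "w = 1 + h x"
    have ev: "\<forall>\<^sub>F y in nhds x. F y \<le> F x"
      using eventually_positive[OF open_UNIV UNIV_I continuous_on_cutoff \<eta>pos]
      by eventually_elim (intro x(2), auto simp: D_def)
    define a b where "a = partial e2 u x" and "b = partial e3 u x"
    have hab: "h x = a\<^sup>2 + b\<^sup>2" by (simp add: h_def grad_def norm_Pair a_def b_def)
    then have wab: "w = 1 + a\<^sup>2 + b\<^sup>2" by (simp add: w_def)
    obtain U H V where jets:
      "\<And>d. djet u x d (fst d * a + snd d * b) (U d)"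
      "U e2 + U e3 + U (b, -a) + w * b = 0"
      "\<And>d. djet h x d (H d) (V d)"
      "(3 * h x + 1) * ((H e2)\<^sup>2 + (H e3)\<^sup>2 + (H (b, -a))\<^sup>2)
         \<le> 2 * w * h x * (V e2 + V e3 + V (b, -a) + w * H e3)"
      using soliton_jets[OF S xO u] unfolding h_def a_def b_def w_def by metis
    obtain E1 E2 where E: "\<And>d. djet (cutoff p R) x d (E1 d) (E2 d)"
      "(E1 e2)\<^sup>2 + (E1 e3)\<^sup>2 + (E1 (b, -a))\<^sup>2 \<le> 1400 * w / R\<^sup>2"
      "- 225 * w / R\<^sup>2 \<le> E2 e2 + E2 e3 + E2 (b, -a) + w * E1 e3"
      using cutoff_jets[OF R x0, where a=a and b=b, folded wab] by blast
    define v where "v d = fst d * a + snd d * b" for d :: plane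
    have jF: "djet F x d (2 * \<eta> * E1 d * h x + \<eta>\<^sup>2 * H d + \<mu> * (2 * u x * v d))
      ((2 * (E1 d)\<^sup>2 + 2 * \<eta> * E2 d) * h x + 4 * \<eta> * E1 d * H d + \<eta>\<^sup>2 * V d
        + \<mu> * (2 * (v d)\<^sup>2 + 2 * u x * U d))" for d
      by (rule djet_cong[OF djet_add[OF djet_mult[OF djet_power2[OF E(1)] jets(3)]
            djet_cmult[OF djet_power2[OF jets(1)], of \<mu>]]])
        (auto simp: F_def \<eta>_def v_def)
    have "2 * \<mu> \<le> 6 * ((E1 e2)\<^sup>2 + (E1 e3)\<^sup>2 + (E1 (b, -a))\<^sup>2)
       - 2 * \<eta> * (E2 e2 + E2 e3 + E2 (b, -a) + w * E1 e3)"
    proof (rule cutoff_gradient_plus_square_max[OF hp w_def djet_local_max(1)[OF jF ev] djet_local_max(2)[OF jF ev]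
        djet_local_max(2)[OF jF ev] djet_local_max(2)[OF jF ev] jets(4)])
      show "(v e2)\<^sup>2 + (v e3)\<^sup>2 + (v (b, - a))\<^sup>2 = h x"
        by (simp add: v_def e2_def e3_def hab)
      show "U e2 + U e3 + U (b, - a) + w * v e3 = 0" using jets(2) by (simp add: v_def e3_def)
    qed
    moreover have "\<eta> * (- 225 * w / R\<^sup>2) \<le> \<eta> * (E2 e2 + E2 e3 + E2 (b, -a) + w * E1 e3)"
      using E(3) \<eta>pos by (intro mult_left_mono) (auto simp: \<eta>_def)
    moreover have "\<eta> * (225 * w / R\<^sup>2) \<le> 3 * (225 * w / R\<^sup>2)"
      using cutoff_nonneg(5)[OF R x0] hp Rp by (intro mult_right_mono) (auto simp: \<eta>_def w_def)
    ultimately have "2 * \<mu> \<le> 9750 * (w / R\<^sup>2)" using E(2) by simp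
    also have "w / R\<^sup>2 \<le> B / R\<^sup>2"
      using B[OF cutoff_nonneg(1)[OF R x0]] Rp by (intro divide_right_mono) (auto simp: w_def h_def)
    finally have "14000 * (B / R\<^sup>2) \<le> 9750 * (B / R\<^sup>2)" by (simp add: \<mu>_def)
    moreover have "B / R\<^sup>2 > 0" using B1 Rp by simp
    ultimately show False by linarith
  qed
  have "(u x)\<^sup>2 \<le> N\<^sup>2" using N[OF xO] by (metis abs_ge_zero power2_abs power_mono)
  then have "F x \<le> \<mu> * N\<^sup>2" using vanish lp by (auto simp: F_def)
  moreover have "h p \<le> F p" using lp by (simp add: F_def cutoff_center)
  ultimately show ?thesis using x(2)[OF pD] by (simp add: h_def \<mu>_def)
qed

section \<open>Combination of the two estimates\<close>

text \<open>The bound of \<open>gradient_decay\<close> with the constant of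
  \<open>gradient_bound\<close> as \<open>B\<close>; the factor 2 accounts for working at half the
  width.\<close>

definition decay_const :: "real \<Rightarrow> real" where
  "decay_const N = 2 * sqrt (7000 * (exp (3000000 * N\<^sup>2) * (6000000 * N\<^sup>2)) * N\<^sup>2)"

text \<open>Radii of the balls and upward shifts both add up. This gives every point of the smaller
  sausage room for a sausage of its own.\<close>

lemma upward_sausage_nested:
  assumes "\<rho> > 0" "x \<in> upward_sausage (\<rho> / 2) p"
  shows "upward_sausage (\<rho> / 2) x \<subseteq> upward_sausage \<rho> p"
proof
  fix y assume "y \<in> upward_sausage (\<rho> / 2) x"
  then obtain t q where y: "0 \<le> t" "t < (\<rho> / 2)\<^sup>2" "dist x q < \<rho> / 2" "y = q + t *\<^sub>R e3"
    by (auto simp: upward_sausage_def)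
  obtain t' q' where x: "0 \<le> t'" "t' < (\<rho> / 2)\<^sup>2" "dist p q' < \<rho> / 2" "x = q' + t' *\<^sub>R e3"
    using assms(2) by (auto simp: upward_sausage_def)
  have "dist p (q - t' *\<^sub>R e3) \<le> dist p q' + dist q' (q - t' *\<^sub>R e3)" by (rule dist_triangle)
  also have "dist q' (q - t' *\<^sub>R e3) = dist x q" by (simp add: x dist_norm algebra_simps)
  finally have "dist p (q - t' *\<^sub>R e3) < \<rho>" using x y by simp
  moreover have "t + t' < \<rho>\<^sup>2" using x y by (simp add: power_divide)
  moreover have "y = (q - t' *\<^sub>R e3) + (t + t') *\<^sub>R e3" by (simp add: y algebra_simps)
  ultimately show "y \<in> upward_sausage \<rho> p"
    unfolding upward_sausage_def using x y by (intro UN_I[of "t + t'"] image_eqI[of _ _ "q - t' *\<^sub>R e3"]) auto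
qed

text \<open>The first estimate holds at every point of the sausage of half width, since nested
  sausages stay in \<Omega>; it supplies the bound \<open>B\<close> for the second estimate at
  \<open>p\<close>.\<close>

lemma gradient_estimate:
  assumes S: "open \<Omega>" and u: "translating_soliton_on \<Omega> u"
    and \<rho>: "\<rho> \<ge> 1 / 2" and p: "upward_sausage \<rho> p \<subseteq> \<Omega>"
    and N: "N \<ge> 1" "\<And>x. x \<in> \<Omega> \<Longrightarrow> \<bar>u x\<bar> \<le> N"
  shows "norm (grad u p) \<le> decay_const N / \<rho>"
proof -
  let ?B = "exp (3000000 * N\<^sup>2) * (6000000 * N\<^sup>2)"
  have R: "\<rho> / 2 \<ge> 1 / 4" and \<rho>p: "\<rho> > 0" using \<rho> by auto
  have nested: "upward_sausage (\<rho> / 2) x \<subseteq> \<Omega>" if "x \<in> upward_sausage (\<rho> / 2) p" for x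
    using upward_sausage_nested[OF \<rho>p that] p by blast
  have "1 + (norm (grad u x))\<^sup>2 \<le> ?B" if "x \<in> upward_sausage (\<rho> / 2) p" for x
    by (rule gradient_bound[OF S u R nested[OF that] N])
  from gradient_decay[OF S u R nested[OF upward_sausage_center] N(2) this]
  have "(norm (grad u p))\<^sup>2 \<le> 7000 * ?B / (\<rho> / 2)\<^sup>2 * N\<^sup>2" using \<rho>p by simp
  then have "norm (grad u p) \<le> sqrt (7000 * ?B / (\<rho> / 2)\<^sup>2 * N\<^sup>2)" by (rule real_le_rsqrt)
  also have "\<dots> = sqrt (7000 * ?B * N\<^sup>2 / (\<rho> / 2)\<^sup>2)" by (simp add: mult_ac)
  also have "\<dots> = decay_const N / \<rho>"
    unfolding real_sqrt_divide decay_const_def using \<rho>p by simp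
  finally show ?thesis .
qed

section \<open>Distance to the frontier\<close>

lemma segment_meets_frontier:
  fixes x y :: plane
  assumes "x \<in> S" "y \<notin> S"
  obtains z where "z \<in> frontier S" "dist x z \<le> dist x y" "dist z y \<le> dist x y"
proof -
  have "closed_segment x y \<inter> frontier S \<noteq> {}"
    using assms by (intro connected_Int_frontier connected_segment) auto
  then obtain z where z: "z \<in> closed_segment x y" "z \<in> frontier S" by blast
  have "dist x z \<le> dist x y" "dist z y \<le> dist x y"
    using dist_in_closed_segment[OF z(1)] by (simp_all add: dist_commute)
  with z show thesis using that by blast
qed

lemma ball_infdist_frontier_subset:
  fixes p :: plane
  assumes "p \<in> S"
  shows "ball p (infdist p (frontier S)) \<subseteq> S"
proof
  fix y assume y: "y \<in> ball p (infdist p (frontier S))"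
  show "y \<in> S"
  proof (rule ccontr)
    assume "y \<notin> S"
    then obtain z where "z \<in> frontier S" "dist p z \<le> dist p y"
      using segment_meets_frontier[OF assms] by metis
    then show False using infdist_le[of z "frontier S" p] y by auto
  qed
qed

text \<open>A ball of radius \<open>d\<close> only contains a sausage of width of order \<open>\<surd>d\<close>, whence the weaker rate without the
  sausages property.\<close>

lemma upward_sausage_subset_ball:
  assumes "d \<ge> 1"
  shows "upward_sausage (sqrt d / 2) p \<subseteq> ball p d"
proof
  fix x assume "x \<in> upward_sausage (sqrt d / 2) p"
  then obtain t q where x: "0 \<le> t" "t < (sqrt d / 2)\<^sup>2" "dist p q < sqrt d / 2" "x = q + t *\<^sub>R e3"
    by (auto simp: upward_sausage_def)
  have "sqrt d \<le> d" using assms by (simp add: real_le_lsqrt real_sqrt_le_iff' power2_eq_square)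
  have "dist p x \<le> dist p q + dist q x" by (rule dist_triangle)
  also have "dist q x = t" using x by (simp add: dist_norm e3_def norm_Pair)
  finally have "dist p x < sqrt d / 2 + d / 4" using x assms by (simp add: power_divide)
  then show "x \<in> ball p d" using \<open>sqrt d \<le> d\<close> assms by simp
qed

text \<open>A nearest frontier point \<open>y\<close> of the open set \<Omega> lies outside
  \<open>\<Omega>'\<close>, so the segment from \<open>p\<close> to \<open>y\<close> crosses the
  frontier of \<open>\<Omega>'\<close> at a point no farther from \<open>y\<close> than
  \<open>p\<close> is.\<close>

lemma one_le_infdist_frontier:
  assumes S: "open \<Omega>" "\<Omega>' \<subseteq> \<Omega>" "p \<in> \<Omega>'" and ne: "frontier \<Omega> \<noteq> {}"
    and d: "1 \<le> ext_setdist (frontier \<Omega>') (frontier \<Omega>)"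
  shows "1 \<le> infdist p (frontier \<Omega>)"
proof -
  obtain y where y: "y \<in> frontier \<Omega>" "infdist p (frontier \<Omega>) = dist p y"
    using infdist_attains_inf[OF frontier_closed ne] by blast
  have "y \<notin> \<Omega>'" using y(1) S frontier_disjoint_eq[of \<Omega>] by blast
  then obtain z where z: "z \<in> frontier \<Omega>'" "dist z y \<le> dist p y"
    using segment_meets_frontier[OF S(3)] by metis
  have "ext_setdist (frontier \<Omega>') (frontier \<Omega>) \<le> ereal (dist z y)"
    unfolding ext_setdist_def using z(1) y(1) by (meson INF_lower2 order_refl)
  then have "1 \<le> ereal (dist z y)" using d by (rule order_trans[rotated])
  then show ?thesis using z y by (simp add: one_ereal_def)
qed

section \<open>Estimates in terms of the supremum norm\<close>

lemma decay_const_pos: "N \<ge> 1 \<Longrightarrow> decay_const N > 0"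
  by (simp add: decay_const_def)

lemma le_sup_norm_on:
  assumes "bounded (u ` \<Omega>)" "x \<in> \<Omega>"
  shows "\<bar>u x\<bar> \<le> sup_norm_on \<Omega> u"
proof -
  obtain B where "\<forall>y\<in>\<Omega>. \<bar>u y\<bar> \<le> B" using assms(1) by (auto simp: bounded_iff)
  then have "bdd_above ((\<lambda>y. \<bar>u y\<bar>) ` \<Omega>)" by (intro bdd_aboveI2[of _ _ B]) auto
  then show ?thesis unfolding sup_norm_on_def using assms(2) by (rule cSUP_upper[rotated])
qed

lemma gradient_estimate_sup_norm:
  assumes "open \<Omega>" "translating_soliton_on \<Omega> u" "bounded (u ` \<Omega>)"
    and "\<rho> \<ge> 1 / 2" "upward_sausage \<rho> p \<subseteq> \<Omega>"
  shows "norm (grad u p) \<le> decay_const (\<bar>sup_norm_on \<Omega> u\<bar> + 1) / \<rho>"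
proof (rule gradient_estimate[OF assms(1,2,4,5)])
  show "\<bar>u x\<bar> \<le> \<bar>sup_norm_on \<Omega> u\<bar> + 1" if "x \<in> \<Omega>" for x
    using le_sup_norm_on[OF assms(3) that] by linarith
qed simp

text \<open>Sausages of every width fit into the plane, so the width can tend to infinity in the
  estimate.\<close>

lemma bounded_entire_grad_eq_0:
  assumes "translating_soliton_on UNIV u" "bounded (range u)"
  shows "grad u p = 0"
proof -
  let ?C = "decay_const (\<bar>sup_norm_on UNIV u\<bar> + 1)"
  have "\<forall>\<^sub>F \<rho> in at_top. norm (grad u p) \<le> ?C / \<rho>"
    using eventually_ge_at_top[of "1 / 2"]
    by eventually_elim (rule gradient_estimate_sup_norm[OF open_UNIV assms], auto)
  moreover have "((\<lambda>\<rho>. ?C / \<rho>) \<longlongrightarrow> 0) at_top"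
    by (intro tendsto_divide_0[OF tendsto_const] filterlim_mono[OF filterlim_ident]) (auto simp: at_top_le_at_infinity)
  ultimately have "norm (grad u p) \<le> 0"
    by (intro tendsto_lowerbound[of _ _ at_top "norm (grad u p)"]) auto
  then show ?thesis by simp
qed

theorem proposition3p9:
  shows "(\<exists>K :: real \<Rightarrow> real. (\<forall>M. 0 < K M) \<and>
    (\<forall>(\<Omega> :: plane set) (\<Omega>' :: plane set) (u :: plane \<Rightarrow> real).
       open \<Omega> \<and> connected \<Omega> \<and>
       translating_soliton_on \<Omega> u \<and> bounded (u ` \<Omega>) \<and>
       \<Omega>' \<subset> \<Omega> \<and> 1 \<le> ext_setdist (frontier \<Omega>') (frontier \<Omega>) \<longrightarrow>
       (\<forall>p\<in>\<Omega>'. norm (grad u p) \<le>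
          (if frontier \<Omega> = {} then 0
           else K (sup_norm_on \<Omega> u) / sqrt (infdist p (frontier \<Omega>)))))) \<and>
   (\<exists>K :: real \<Rightarrow> real. (\<forall>M. 0 < K M) \<and>
    (\<forall>(\<Omega> :: plane set) (\<Omega>' :: plane set) (u :: plane \<Rightarrow> real).
       open \<Omega> \<and> connected \<Omega> \<and> upward_sausages_property \<Omega> \<and>
       translating_soliton_on \<Omega> u \<and> bounded (u ` \<Omega>) \<and>
       \<Omega>' \<subset> \<Omega> \<and> 1 \<le> ext_setdist (frontier \<Omega>') (frontier \<Omega>) \<longrightarrow>
       (\<forall>p\<in>\<Omega>'. norm (grad u p) \<le>
          (if frontier \<Omega> = {} then 0
           else K (sup_norm_on \<Omega> u) / infdist p (frontier \<Omega>)))))"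
proof -
  \<comment> \<open>Passing to \<open>\<bar>M\<bar> + 1\<close> gives an admissible bound
    \<open>N \<ge> 1\<close>, and a positive \<open>K\<close>, for every real \<open>M\<close>. The
    factor 2 compensates for the width \<open>sqrt d / 2\<close> in the general case.\<close>
  define K where "K M = 2 * decay_const (\<bar>M\<bar> + 1)" for M :: real
  have K: "0 < K M" for M using decay_const_pos[of "\<bar>M\<bar> + 1"] by (simp add: K_def)
  have est: "norm (grad u p) \<le> K (sup_norm_on \<Omega> u) / 2 / \<rho>"
    if "open \<Omega>" "translating_soliton_on \<Omega> u" "bounded (u ` \<Omega>)" "\<rho> \<ge> 1 / 2" "upward_sausage \<rho> p \<subseteq> \<Omega>"
    for \<Omega> u p \<rho>
    using gradient_estimate_sup_norm[OF that] by (simp add: K_def)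
  have entire: "norm (grad u p) \<le> 0"
    if "translating_soliton_on \<Omega> u" "bounded (u ` \<Omega>)" "p \<in> \<Omega>" "frontier \<Omega> = {}" for \<Omega> u p
  proof -
    have "\<Omega> = UNIV" using that(3,4) frontier_eq_empty by blast
    then show ?thesis using bounded_entire_grad_eq_0 that by simp
  qed
  have weak: "norm (grad u p) \<le>
      (if frontier \<Omega> = {} then 0 else K (sup_norm_on \<Omega> u) / sqrt (infdist p (frontier \<Omega>)))"
    if A: "open \<Omega>" "translating_soliton_on \<Omega> u" "bounded (u ` \<Omega>)" "\<Omega>' \<subset> \<Omega>"
      "1 \<le> ext_setdist (frontier \<Omega>') (frontier \<Omega>)" "p \<in> \<Omega>'" for \<Omega> \<Omega>' u p
  proof (cases "frontier \<Omega> = {}")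
    case True
    then show ?thesis using entire[OF A(2,3) _ True, of p] A(4,6) by auto
  next
    case False
    let ?d = "infdist p (frontier \<Omega>)"
    have pO: "p \<in> \<Omega>" using A by blast
    have d: "1 \<le> ?d" using one_le_infdist_frontier[of \<Omega> \<Omega>' p] A False by blast
    then have "1 / 2 \<le> sqrt ?d / 2" by simp
    then have "norm (grad u p) \<le> K (sup_norm_on \<Omega> u) / 2 / (sqrt ?d / 2)"
      using est[OF A(1-3)] upward_sausage_subset_ball[OF d] ball_infdist_frontier_subset[OF pO] by blast
    then show ?thesis using False by simp
  qed
  have strong: "norm (grad u p) \<le>
      (if frontier \<Omega> = {} then 0 else K (sup_norm_on \<Omega> u) / infdist p (frontier \<Omega>))"
    if A: "open \<Omega>" "translating_soliton_on \<Omega> u" "bounded (u ` \<Omega>)" "\<Omega>' \<subset> \<Omega>"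
      "1 \<le> ext_setdist (frontier \<Omega>') (frontier \<Omega>)" "p \<in> \<Omega>'" and P: "upward_sausages_property \<Omega>"
    for \<Omega> \<Omega>' u p
  proof (cases "frontier \<Omega> = {}")
    case True
    then show ?thesis using entire[OF A(2,3) _ True, of p] A(4,6) by auto
  next
    case False
    let ?d = "infdist p (frontier \<Omega>)"
    have pO: "p \<in> \<Omega>" using A by blast
    have d: "1 \<le> ?d" using one_le_infdist_frontier[of \<Omega> \<Omega>' p] A False by blast
    have "upward_sausage ?d p \<subseteq> \<Omega>" using P pO False by (auto simp: upward_sausages_property_def)
    then have "norm (grad u p) \<le> K (sup_norm_on \<Omega> u) / 2 / ?d" using est[OF A(1-3)] d by simp
    also have "\<dots> \<le> K (sup_norm_on \<Omega> u) / ?d"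
      using K[of "sup_norm_on \<Omega> u"] d by (intro divide_right_mono) auto
    finally show ?thesis using False by simp
  qed
  show ?thesis
  proof
    show "\<exists>K :: real \<Rightarrow> real. (\<forall>M. 0 < K M) \<and>
    (\<forall>(\<Omega> :: plane set) (\<Omega>' :: plane set) (u :: plane \<Rightarrow> real).
       open \<Omega> \<and> connected \<Omega> \<and>
       translating_soliton_on \<Omega> u \<and> bounded (u ` \<Omega>) \<and>
       \<Omega>' \<subset> \<Omega> \<and> 1 \<le> ext_setdist (frontier \<Omega>') (frontier \<Omega>) \<longrightarrow>
       (\<forall>p\<in>\<Omega>'. norm (grad u p) \<le>
          (if frontier \<Omega> = {} then 0
           else K (sup_norm_on \<Omega> u) / sqrt (infdist p (frontier \<Omega>)))))"
      using K weak by blast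
    show "\<exists>K :: real \<Rightarrow> real. (\<forall>M. 0 < K M) \<and>
    (\<forall>(\<Omega> :: plane set) (\<Omega>' :: plane set) (u :: plane \<Rightarrow> real).
       open \<Omega> \<and> connected \<Omega> \<and> upward_sausages_property \<Omega> \<and>
       translating_soliton_on \<Omega> u \<and> bounded (u ` \<Omega>) \<and>
       \<Omega>' \<subset> \<Omega> \<and> 1 \<le> ext_setdist (frontier \<Omega>') (frontier \<Omega>) \<longrightarrow>
       (\<forall>p\<in>\<Omega>'. norm (grad u p) \<le>
          (if frontier \<Omega> = {} then 0
           else K (sup_norm_on \<Omega> u) / infdist p (frontier \<Omega>))))"
      using K strong by blast
  qed
qed

end
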